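(* Let $w\in\mathbb{C}$ and let $a,b>0$ with $ab=\pi^2$. Then \begin{align*} &e^{-\frac{w^2}{4}}\sum_{n=1}^\infty \sum_{r=0}^{\infty}\frac{\sigma_{-1}(n)e^{-2na}}{r!\left(\frac{1}{2}\right)_r\left(\frac{1}{2}\right)_{2r}}\Phi_3\!\left(\frac{1}{2};\frac{1}{2}+2r;\frac{w^2}{4},\frac{w^2n a}{2}\right)\left(\frac{w^2na}{4}\right)^{2r}\\ &\qquad- e^{\frac{w^2}{4}}\sum_{n=1}^\infty \sum_{r=0}^{\infty}\frac{\sigma_{-1}(n)e^{-2nb}}{r!\left(\frac{1}{2}\right)_r\left(\frac{1}{2}\right)_{2r}}\Phi_3\!\left(\frac{1}{2};\frac{1}{2}+2r;-\frac{w^2}{4},-\frac{w^2n b}{2}\right)\left(\frac{w^2nb}{4}\right)^{2r}\\ &=\frac{1}{4}\left[\log\frac{a}{b}-\frac{w^2}{2}\left({}_2F_2\!\left(1,1;\tfrac{3}{2},2;\tfrac{w^2}{4}\right)+{}_2F_2\!\left(1,1;\tfrac{3}{2},2;-\tfrac{w^2}{4}\right)\right)\right]\\ &\qquad+\frac{1}{12}\left[b\left(1+\frac{w\sqrt{\pi}}{2}e^{\frac{w^2}{4}}\mathrm{erf}\!\left(\frac{w}{2}\right)\right)-a\left(1-\frac{w\sqrt{\pi}}{2}e^{-\frac{w^2}{4}}\mathrm{erfi}\!\left(\frac{w}{2}\right)\right)\right]. \end{align*}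
   Context: $\sigma_{-1}(n)=\sum_{d\mid n}d^{-1}$. For $a\in\mathbb{C}$, $(a)_m=a(a+1)\cdots(a+m-1)$, $(a)_0=1$. The Humbert function is $\Phi_3(a;c;x,y)=\sum_{m,n\ge 0}\frac{(a)_m}{(c)_{m+n}}\frac{x^m y^n}{m!\,n!}$. ${}_2F_2(a_1,a_2;b_1,b_2;z)=\sum_{m\ge0}\frac{(a_1)_m(a_2)_m}{(b_1)_m(b_2)_m}\frac{z^m}{m!}$. The error function is $\mathrm{erf}(w)=\frac{2}{\sqrt{\pi}}\int_0^w e^{-t^2}dt$ and the imaginary error function is $\mathrm{erfi}(w)=\frac{2}{\sqrt{\pi}}\int_0^w e^{t^2}dt$. *)

theory Defs
  imports "HOL-Complex_Analysis.Complex_Analysis"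
begin

definition sigma_m1 :: "nat \<Rightarrow> real" where
  "sigma_m1 n = (\<Sum>d\<in>{d. d dvd n}. 1 / real d)"

definition Humbert_Phi3 :: "complex \<Rightarrow> complex \<Rightarrow> complex \<Rightarrow> complex \<Rightarrow> complex" where
  "Humbert_Phi3 a c x y =
     (\<Sum>m. \<Sum>n. pochhammer a m / pochhammer c (m + n) * x ^ m * y ^ n
                 / (of_nat (fact m) * of_nat (fact n)))"

definition hyp2F2 :: "complex \<Rightarrow> complex \<Rightarrow> complex \<Rightarrow> complex \<Rightarrow> complex \<Rightarrow> complex" where
  "hyp2F2 a1 a2 b1 b2 z =
     (\<Sum>m. pochhammer a1 m * pochhammer a2 m / (pochhammer b1 m * pochhammer b2 m)
            * z ^ m / of_nat (fact m))"

definition cerf :: "complex \<Rightarrow> complex" where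
  "cerf w = 2 / complex_of_real (sqrt pi) * contour_integral (linepath 0 w) (\<lambda>t. exp (- (t ^ 2)))"

definition cerfi :: "complex \<Rightarrow> complex" where
  "cerfi w = 2 / complex_of_real (sqrt pi) * contour_integral (linepath 0 w) (\<lambda>t. exp (t ^ 2))"

end

theory Submission
  imports Defs "HOL-Combinatorics.Stirling"
begin

text \<open>
  Put \<open>z = w\<^sup>2 / 4\<close> and \<open>S(x) = \<Sum>n\<ge>1. \<sigma>\<^sub>-\<^sub>1(n) exp (-2 n x)\<close>. For \<open>w = 0\<close> the theorem is the
  transformation of the logarithm of Dedekind's eta function, which relates \<open>S(a)\<close> and \<open>S(b)\<close>. In general,
  the coefficient of \<open>z\<^sup>k\<close> on the left is \<open>p\<^sub>k(-a d/da) S(a) - (-1)\<^sup>k p\<^sub>k(-b d/db) S(b)\<close>, where the polynomials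
  \<open>p\<^sub>k\<close> have the generating function
  \<open>\<Sum>k. p\<^sub>k(s) z\<^sup>k = exp (-z) \<cdot> \<^sub>1F\<^sub>1((1+s)/2; 1/2; z) \<cdot> \<^sub>1F\<^sub>1(s/2; 1/2; z)
    = \<^sub>1F\<^sub>1(s/2; 1/2; z) \<cdot> \<^sub>1F\<^sub>1(-s/2; 1/2; -z)\<close>
  by Kummer's transformation. The last form is invariant under \<open>(s, z) \<mapsto> (-s, -z)\<close>, so \<open>p\<^sub>k\<close> has the parity
  of \<open>k\<close>; since \<open>a d/da = -b d/db\<close> on the curve \<open>ab = \<pi>\<^sup>2\<close>, the coefficient is \<open>p\<^sub>k(-a d/da)\<close> applied to
  \<open>log (a/b) / 4 + (b - a) / 12\<close>. It involves only \<open>p\<^sub>k(0)\<close>, \<open>p\<^sub>k'(0)\<close> and \<open>p\<^sub>k(\<plusminus>1)\<close>, which sum up to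
  the constant, the \<open>\<^sub>2F\<^sub>2\<close> terms and the error functions.
\<close>

section \<open>The polynomials attached to the Humbert series\<close>

text \<open>The obstacles are analytic. The eta relation comes from the array a / (m^2 a^2 + k^2
  pi^2), whose double sum diverges; only differences of truncations to squares make sense, and the
  boundary terms that they leave are the origin of log (a/b). With a = exp t the Euler operator is
  d/dt and a -> pi^2 / a is the reflection t -> 2 ln pi - t. Each differentiation of the relation
  therefore puts one factor -1 on the b side, and a polynomial whose degrees share one parity sees a
  single global sign. Collecting powers of z requires absolute convergence of the sum over n, r and
  both Humbert indices together. With y = 2 n a the inner series grows at most like exp (y/2),
  because (1/2)_N outgrows every geometric sequence; the weight exp (-y) then leaves a decay of exp
  (-y/2).\<close>

lemma pochhammer_add_convolution:
  fixes a b :: "'a :: field_char_0"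
  shows "(\<Sum>i\<le>n. pochhammer a i / fact i * (pochhammer b (n - i) / fact (n - i))) = pochhammer (a + b) n / fact n"
  unfolding pochhammer_binomial_sum sum_divide_distrib
  by (intro sum.cong) (auto simp: binomial_fact)

lemma pochhammer_minus_of_nat:
  assumes "l \<le> n"
  shows "pochhammer (- of_nat n :: 'a :: field_char_0) l = (-1) ^ l * fact n / fact (n - l)"
proof -
  have "of_nat (n choose l) = (- 1) ^ l * pochhammer (- of_nat n :: 'a) l / fact l"
    by (simp add: binomial_gbinomial gbinomial_pochhammer)
  hence "pochhammer (- of_nat n :: 'a) l = (- 1) ^ l * (of_nat (n choose l) * fact l)"
    by (simp add: field_simps flip: power_add)
  thus ?thesis using assms by (simp add: binomial_fact)
qed

section \<open>Kummer series with lower parameter 1/2\<close>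

lemma pochhammer_half_nonzero [simp]: "pochhammer (1 / 2 :: real) n \<noteq> 0"
  by (rule less_imp_neq[symmetric], rule pochhammer_pos) simp

text \<open>Chu-Vandermonde for the terminating 2F1(a, -n; 1/2; 1). Kummer's transformation and the
  linearisation of products of Kummer coefficients both reduce to it.\<close>

lemma Vandermonde_half:
  fixes a :: real
  shows "(\<Sum>l\<le>n. pochhammer a l * pochhammer (- real n) l / (fact l * pochhammer (1/2) l)) =
         pochhammer (1/2 - a) n / pochhammer (1/2) n"
proof -
  have "\<forall>i\<in>{0..<n}. (1/2 :: real) \<noteq> - real i" by auto
  from Vandermonde_pochhammer[OF this, of a] show ?thesis
    by (simp add: atMost_atLeast0)
qed

text \<open>The series 1F1(a; 1/2; z); the next definition is 1F1(a; 1/2; -z). They are formal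
  because only single coefficients of their products are ever evaluated.\<close>

definition kummer_fps :: "real \<Rightarrow> real fps" where
  "kummer_fps a = Abs_fps (\<lambda>n. pochhammer a n / (pochhammer (1/2) n * fact n))"

definition kummer_fps_neg :: "real \<Rightarrow> real fps" where
  "kummer_fps_neg a = Abs_fps (\<lambda>n. (-1) ^ n * pochhammer a n / (pochhammer (1/2) n * fact n))"

text \<open>The coefficient (-1)^(n-l) / (n-l)! of exp (-z) equals (-1)^n / n! times (-n)_l, so each
  Cauchy product is a terminating 2F1 at argument 1.\<close>

lemma kummer_transformation: "fps_exp (-1) * kummer_fps a = kummer_fps_neg (1/2 - a)"
proof (rule fps_ext)
  fix n
  have "(fps_exp (-1) * kummer_fps a) $ n =
      (\<Sum>l\<le>n. pochhammer a l / (pochhammer (1/2) l * fact l) * ((-1) ^ (n - l) / fact (n - l)))"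
    by (subst mult.commute) (simp add: fps_mult_nth kummer_fps_def atMost_atLeast0)
  also have "\<dots> = (-1) ^ n / fact n * (\<Sum>l\<le>n. pochhammer a l * pochhammer (- real n) l / (fact l * pochhammer (1/2) l))"
    unfolding sum_distrib_left
  proof (intro sum.cong refl)
    fix l assume "l \<in> {..n}"
    hence l: "l \<le> n" by simp
    have "(-1 :: real) ^ n = (-1) ^ (n - l) * (-1) ^ l"
      using l by (simp flip: power_add)
    hence "(-1 :: real) ^ (n - l) = (-1) ^ n * (-1) ^ l"
      by simp
    thus "pochhammer a l / (pochhammer (1/2) l * fact l) * ((-1) ^ (n - l) / fact (n - l)) =
       (-1) ^ n / fact n * (pochhammer a l * pochhammer (- real n) l / (fact l * pochhammer (1/2) l))"
      unfolding pochhammer_minus_of_nat[OF l] by (simp add: field_simps)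
  qed
  also have "\<dots> = kummer_fps_neg (1/2 - a) $ n"
    by (simp add: Vandermonde_half kummer_fps_neg_def)
  finally show "(fps_exp (-1) * kummer_fps a) $ n = kummer_fps_neg (1/2 - a) $ n" .
qed

text \<open>Linearises the product of two Kummer denominators. Since (1/2)_k = (1/2)_j (1/2 + j)_i,
  what remains is (1/2 + j)_i / (1/2)_i, which is the sum in \<open>Vandermonde_half\<close> at a =
  -j; the factor (-j)_l cuts it off beyond j and makes the result symmetric in i and j.\<close>

lemma pochhammer_half_quotient:
  fixes i j :: nat
  assumes "i + j = k"
  shows "pochhammer (1/2) k / (pochhammer (1/2) i * pochhammer (1/2) j * (fact i * fact j)) =
         (\<Sum>l | l \<le> i \<and> l \<le> j. 1 / (fact l * pochhammer (1/2) l * fact (i - l) * fact (j - l)) :: real)"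
proof -
  have "pochhammer (1/2 :: real) k = pochhammer (1/2) j * pochhammer (1/2 + real j) i"
    using assms pochhammer_product'[of "1/2::real" j i] by (simp add: add.commute)
  hence "pochhammer (1/2) k / (pochhammer (1/2) i * pochhammer (1/2) j * (fact i * fact j)) =
      (pochhammer (1/2 - (- real j)) i / pochhammer (1/2) i) / (fact i * fact j)"
    by simp
  also have "\<dots> = (\<Sum>l\<le>i. pochhammer (- real j) l * pochhammer (- real i) l / (fact l * pochhammer (1/2) l) / (fact i * fact j))"
    unfolding Vandermonde_half[symmetric] sum_divide_distrib ..
  also have "\<dots> = (\<Sum>l | l \<le> i \<and> l \<le> j. pochhammer (- real j) l * pochhammer (- real i) l / (fact l * pochhammer (1/2) l) / (fact i * fact j))"
    by (rule sum.mono_neutral_right)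
       (auto, use pochhammer_of_nat_eq_0_lemma[of j, where 'a = real] linorder_not_le in blast)
  also have "\<dots> = (\<Sum>l | l \<le> i \<and> l \<le> j. 1 / (fact l * pochhammer (1/2) l * fact (i - l) * fact (j - l)))"
  proof (intro sum.cong refl)
    fix l assume l: "l \<in> {l. l \<le> i \<and> l \<le> j}"
    define e where "e = (-1 :: real) ^ l"
    have "e * e = 1" by (simp add: e_def)
    moreover have "e * fact j / fact (j - l) * (e * fact i / fact (i - l)) / (fact l * pochhammer (1/2) l) / (fact i * fact j) =
       (e * e) * (1 / (fact l * pochhammer (1/2) l * fact (i - l) * fact (j - l)))" by simp
    ultimately show "pochhammer (- real j) l * pochhammer (- real i) l / (fact l * pochhammer (1/2) l) / (fact i * fact j) =
       1 / (fact l * pochhammer (1/2) l * fact (i - l) * fact (j - l))"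
      using l by (simp add: pochhammer_minus_of_nat flip: e_def)
  qed
  finally show ?thesis .
qed

text \<open>
  After the substitution \<open>y = 2 n a\<close>, the coefficient of \<open>z\<^sup>k y\<^sup>N\<close> in the inner sum over \<open>r\<close> of the theorem.
  In \<open>humbert_poly\<close> the power \<open>y\<^sup>N\<close> becomes a rising factorial because
  \<open>s (s + 1) \<dots> (s + N - 1)\<close> at \<open>s = -y d/dy\<close> maps \<open>exp (-y)\<close> to \<open>y\<^sup>N exp (-y)\<close>.
\<close>

definition humbert_coeff :: "nat \<Rightarrow> nat \<Rightarrow> real" where
  "humbert_coeff k N = pochhammer (1/2) (k - N) / (pochhammer (1/2) k * fact (k - N)) *
     (\<Sum>r | 2 * r \<le> N. 1 / (fact (N - 2 * r) * fact (2 * r)))"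

definition humbert_poly :: "nat \<Rightarrow> real poly" where
  "humbert_poly k = (\<Sum>N\<le>k. smult (humbert_coeff k N) (pochhammer [:0, 1:] N))"

lemma poly_pochhammer: "poly (pochhammer p n) x = pochhammer (poly p x) n"
  by (simp add: pochhammer_prod poly_prod)

lemma poly_humbert_poly: "poly (humbert_poly k) s = (\<Sum>N\<le>k. humbert_coeff k N * pochhammer s N)"
  by (simp add: humbert_poly_def poly_sum poly_pochhammer)

text \<open>For fixed r, the sum over n = N - 2 r convolves (s + 2 r)_n with (1/2)_(k-2r-n) and
  collapses by Chu-Vandermonde. The single sum that remains is the meeting point with the product of
  Kummer series.\<close>

lemma poly_humbert_poly_eq:
  "poly (humbert_poly k) s =
     (\<Sum>r | 2 * r \<le> k. pochhammer s (2 * r) / fact (2 * r) * (pochhammer (s + 1/2 + real (2 * r)) (k - 2 * r) / fact (k - 2 * r))) / pochhammer (1/2) k"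
proof -
  have fin: "finite {r. 2 * r \<le> N}" for N :: nat
    by (rule finite_subset[of _ "{..N}"]) auto
  define t where "t r n = pochhammer s (2 * r) / fact (2 * r) *
     (pochhammer (s + real (2 * r)) n / fact n * (pochhammer (1/2) (k - 2 * r - n) / fact (k - 2 * r - n)))" for r n
  have "pochhammer (1/2) k * poly (humbert_poly k) s =
      (\<Sum>N\<le>k. \<Sum>r | 2 * r \<le> N. t r (N - 2 * r))"
    unfolding poly_humbert_poly humbert_coeff_def sum_distrib_left sum_distrib_right
  proof (intro sum.cong refl)
    fix N r assume "N \<in> {..k}" "r \<in> {r. 2 * r \<le> N}"
    hence r: "2 * r \<le> N" "N \<le> k" by auto
    have "pochhammer s N = pochhammer s (2 * r) * pochhammer (s + real (2 * r)) (N - 2 * r)"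
      using pochhammer_product'[of s "2 * r" "N - 2 * r"] r by simp
    moreover have "k - 2 * r - (N - 2 * r) = k - N" using r by simp
    ultimately show "pochhammer (1/2) k * (pochhammer (1/2) (k - N) / (pochhammer (1/2) k * fact (k - N)) *
        (1 / (fact (N - 2 * r) * fact (2 * r))) * pochhammer s N) = t r (N - 2 * r)"
      using r by (simp add: t_def mult_ac del: of_nat_mult)
  qed
  also have "\<dots> = (\<Sum>(N, r)\<in>(SIGMA N:{..k}. {r. 2 * r \<le> N}). t r (N - 2 * r))"
    by (rule sum.Sigma) (auto simp: fin)
  also have "\<dots> = (\<Sum>(r, n)\<in>(SIGMA r:{r. 2 * r \<le> k}. {..k - 2 * r}). t r n)"
    by (rule sum.reindex_bij_witness[of _ "\<lambda>(r, n). (n + 2 * r, r)" "\<lambda>(N, r). (r, N - 2 * r)"]) auto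
  also have "\<dots> = (\<Sum>r | 2 * r \<le> k. \<Sum>n\<le>k - 2 * r. t r n)"
    by (rule sum.Sigma[symmetric]) (auto simp: fin)
  also have "\<dots> = (\<Sum>r | 2 * r \<le> k. pochhammer s (2 * r) / fact (2 * r) *
                      (pochhammer (s + real (2 * r) + 1/2) (k - 2 * r) / fact (k - 2 * r)))"
    unfolding t_def sum_distrib_left[symmetric] pochhammer_add_convolution ..
  finally show ?thesis by (simp add: field_simps)
qed

text \<open>After linearising the denominators by an index l, the duplication formula (s)_(2l) = 4^l
  (s/2)_l ((1+s)/2)_l splits off the factor depending on l alone. The rest is a convolution in i
  with parameters (1+s)/2 + l and s/2 + l, whose sum is s + 1/2 + 2 l.\<close>

lemma poly_humbert_poly_fps:
  "poly (humbert_poly k) s = (kummer_fps ((1 + s) / 2) * kummer_fps (s / 2)) $ k"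
proof -
  have fin: "finite {r. 2 * r \<le> N}" for N :: nat
    by (rule finite_subset[of _ "{..N}"]) auto
  define A where "A l i = pochhammer ((1 + s) / 2 + real l) i / fact i" for l i
  define B where "B l i = pochhammer (s / 2 + real l) i / fact i" for l i
  define t where "t l i = pochhammer s (2 * l) / fact (2 * l) * (A l i * B l (k - 2 * l - i))" for l i
  have "pochhammer (1/2) k * (kummer_fps ((1 + s) / 2) * kummer_fps (s / 2)) $ k =
      (\<Sum>i\<le>k. \<Sum>l | l \<le> i \<and> l \<le> k - i. t l (i - l))"
    unfolding fps_mult_nth sum_distrib_left atMost_atLeast0
  proof (intro sum.cong refl)
    fix i assume "i \<in> {0..k}"
    hence i: "i + (k - i) = k" by simp
    have "pochhammer (1/2) k * (kummer_fps ((1 + s) / 2) $ i * kummer_fps (s / 2) $ (k - i)) =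
      pochhammer ((1 + s) / 2) i * pochhammer (s / 2) (k - i) *
       (pochhammer (1/2) k / (pochhammer (1/2) i * pochhammer (1/2) (k - i) * (fact i * fact (k - i))))"
      by (simp add: kummer_fps_def mult_ac)
    also have "\<dots> = (\<Sum>l | l \<le> i \<and> l \<le> k - i. t l (i - l))"
      unfolding pochhammer_half_quotient[OF i] sum_distrib_left
    proof (intro sum.cong refl)
      fix l assume l: "l \<in> {l. l \<le> i \<and> l \<le> k - i}"
      have 1: "pochhammer ((1 + s) / 2) i = pochhammer ((1 + s) / 2) l * (A l (i - l) * fact (i - l))"
        using pochhammer_product'[of "(1 + s) / 2" l "i - l"] l by (simp add: A_def)
      have 2: "pochhammer (s / 2) (k - i) = pochhammer (s / 2) l * (B l (k - i - l) * fact (k - i - l))"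
        using pochhammer_product'[of "s / 2" l "k - i - l"] l by (simp add: B_def del: diff_diff_left)
      have 3: "pochhammer s (2 * l) = 4 ^ l * (pochhammer (s / 2) l * pochhammer ((1 + s) / 2) l)"
        using pochhammer_double[of "s / 2" l] by (simp add: power_mult add_divide_distrib add.commute)
      have 4: "fact (2 * l) = (4 ^ l * (pochhammer (1/2) l * fact l) :: real)"
        using fact_double[of l, where ?'a = real] by (simp add: power_mult)
      have 5: "k - 2 * l - (i - l) = k - i - l" using l i by auto
      show "pochhammer ((1 + s) / 2) i * pochhammer (s / 2) (k - i) *
          (1 / (fact l * pochhammer (1/2) l * fact (i - l) * fact (k - i - l))) = t l (i - l)"
        unfolding t_def 1 2 3 4 5 by (simp add: field_simps)
    qed
    finally show "pochhammer (1/2) k * (kummer_fps ((1 + s) / 2) $ i * kummer_fps (s / 2) $ (k - i)) =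
      (\<Sum>l | l \<le> i \<and> l \<le> k - i. t l (i - l))" .
  qed
  also have "\<dots> = (\<Sum>(i, l)\<in>(SIGMA i:{..k}. {l. l \<le> i \<and> l \<le> k - i}). t l (i - l))"
    by (rule sum.Sigma) auto
  also have "\<dots> = (\<Sum>(l, i)\<in>(SIGMA l:{l. 2 * l \<le> k}. {..k - 2 * l}). t l i)"
    by (rule sum.reindex_bij_witness[of _ "\<lambda>(l, i). (i + l, l)" "\<lambda>(i, l). (l, i - l)"]) auto
  also have "\<dots> = (\<Sum>l | 2 * l \<le> k. \<Sum>i\<le>k - 2 * l. t l i)"
    by (rule sum.Sigma[symmetric]) (auto simp: fin)
  also have "\<dots> = (\<Sum>l | 2 * l \<le> k. pochhammer s (2 * l) / fact (2 * l) *
                      (pochhammer (s + 1/2 + real (2 * l)) (k - 2 * l) / fact (k - 2 * l)))"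
    unfolding t_def A_def B_def sum_distrib_left[symmetric] pochhammer_add_convolution
    by (intro sum.cong refl arg_cong2[of _ _ _ _ "(*)"] arg_cong2[of _ _ _ _ "(/)"] arg_cong2[of _ _ _ _ pochhammer])
       (simp_all add: field_simps)
  also have "\<dots> = pochhammer (1/2) k * poly (humbert_poly k) s"
    by (simp add: poly_humbert_poly_eq)
  finally show ?thesis by simp
qed

text \<open>These are the \<open>p\<^sub>k\<close>; the factor \<open>exp (-z)\<close> is what makes them even or odd.\<close>

definition parity_poly :: "nat \<Rightarrow> real poly" where
  "parity_poly k = (\<Sum>j\<le>k. smult ((-1) ^ (k - j) / fact (k - j)) (humbert_poly j))"

section \<open>Parity, special values and linear coefficient of \<open>parity_poly\<close>\<close>

lemma poly_parity_poly_fps1: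
  "poly (parity_poly k) s = (fps_exp (-1) * (kummer_fps ((1 + s) / 2) * kummer_fps (s / 2))) $ k"
  unfolding mult.commute[of "fps_exp (-1)"] fps_mult_nth[of _ "fps_exp (-1)"]
  by (simp add: parity_poly_def poly_sum poly_humbert_poly_fps atMost_atLeast0 mult.commute)

text \<open>Kummer's transformation is applied to only one of the two factors: 1/2 - (1+s)/2 = -s/2
  makes it the mirror image of the other one.\<close>

lemma poly_parity_poly_fps:
  "poly (parity_poly k) s = (kummer_fps (s / 2) * kummer_fps_neg (- s / 2)) $ k"
proof -
  have "fps_exp (-1) * (kummer_fps ((1 + s) / 2) * kummer_fps (s / 2)) =
     (fps_exp (-1) * kummer_fps ((1 + s) / 2)) * kummer_fps (s / 2)" by (simp only: mult.assoc)
  also have "\<dots> = kummer_fps (s / 2) * kummer_fps_neg (- s / 2)"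
    unfolding kummer_transformation by (simp add: add_divide_distrib diff_divide_distrib mult.commute)
  finally show ?thesis by (simp only: poly_parity_poly_fps1)
qed

text \<open>The substitution s -> -s exchanges the two factors up to the sign of z, which in the
  Cauchy product is the reversal i -> k - i.\<close>

lemma poly_parity_poly_minus: "poly (parity_poly k) (- s) = (-1) ^ k * poly (parity_poly k) s"
proof -
  define c where "c i = 1 / (pochhammer (1/2) i * fact i :: real)" for i
  have "poly (parity_poly k) (- s) = (\<Sum>i=0..k. c i * pochhammer (- s / 2) i * ((-1) ^ (k - i) * (c (k - i) * pochhammer (s / 2) (k - i))))"
    by (simp add: poly_parity_poly_fps fps_mult_nth kummer_fps_def kummer_fps_neg_def c_def)
  also have "\<dots> = (\<Sum>i=0..k. c (k - i) * pochhammer (- s / 2) (k - i) * ((-1) ^ i * (c i * pochhammer (s / 2) i)))"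
    by (rule sum.reindex_bij_witness[of _ "\<lambda>i. k - i" "\<lambda>i. k - i"]) auto
  also have "\<dots> = (-1) ^ k * (\<Sum>i=0..k. c i * pochhammer (s / 2) i * ((-1) ^ (k - i) * (c (k - i) * pochhammer (- s / 2) (k - i))))"
    unfolding sum_distrib_left
  proof (intro sum.cong refl)
    fix i assume "i \<in> {0..k}"
    hence "(-1 :: real) ^ k = (-1) ^ i * (-1) ^ (k - i)" by (simp flip: power_add)
    hence e: "(-1 :: real) ^ i = (-1) ^ k * (-1) ^ (k - i)" by simp
    show "c (k - i) * pochhammer (- s / 2) (k - i) * ((-1) ^ i * (c i * pochhammer (s / 2) i)) =
      (-1) ^ k * (c i * pochhammer (s / 2) i * ((-1) ^ (k - i) * (c (k - i) * pochhammer (- s / 2) (k - i))))"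
      unfolding e by (simp only: mult_ac)
  qed
  also have "(\<Sum>i=0..k. c i * pochhammer (s / 2) i * ((-1) ^ (k - i) * (c (k - i) * pochhammer (- s / 2) (k - i)))) = poly (parity_poly k) s"
    by (simp add: poly_parity_poly_fps fps_mult_nth kummer_fps_def kummer_fps_neg_def c_def)
  finally show ?thesis .
qed

text \<open>Parity in the form in which it is substituted later: the sign (-1)^j next to a
  coefficient may be replaced by (-1)^k.\<close>

lemma coeff_parity_poly_parity: "(-1) ^ j * coeff (parity_poly k) j = (-1) ^ k * coeff (parity_poly k) j"
proof -
  have "pcompose (parity_poly k) [:0, -1:] = smult ((-1) ^ k) (parity_poly k)"
    by (rule poly_eq_poly_eq_iff[THEN iffD1, OF ext]) (simp add: poly_pcompose poly_parity_poly_minus)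
  thus ?thesis by (metis coeff_pcompose_linear coeff_smult)
qed

lemma poly_parity_poly_0: "poly (parity_poly k) 0 = (if k = 0 then 1 else 0)"
proof (cases "k = 0")
  case False
  have "(kummer_fps 0 * kummer_fps_neg 0) $ k = 0"
    unfolding fps_mult_nth
    by (rule sum.neutral) (use False in \<open>auto simp: kummer_fps_def kummer_fps_neg_def pochhammer_0_left\<close>)
  with False show ?thesis by (simp add: poly_parity_poly_fps)
qed (simp add: poly_parity_poly_fps kummer_fps_def kummer_fps_neg_def)

text \<open>At s = -1 the factor with parameter (1+s)/2 = 0 is 1, and Kummer's transformation turns
  the other one into 1F1(1; 1/2; -z).\<close>

lemma poly_parity_poly_minus_1: "poly (parity_poly k) (-1) = (-1) ^ k / pochhammer (1/2) k"
proof -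
  have "poly (parity_poly k) (-1) = (kummer_fps 0 * (fps_exp (-1) * kummer_fps (-1/2))) $ k"
    unfolding poly_parity_poly_fps1 by (simp add: mult_ac)
  also have "kummer_fps 0 = 1"
    by (rule fps_ext) (simp add: kummer_fps_def pochhammer_0_left)
  finally show ?thesis
    by (simp add: kummer_transformation kummer_fps_neg_def flip: pochhammer_fact)
qed

lemma poly_parity_poly_1: "poly (parity_poly k) 1 = 1 / pochhammer (1/2) k"
  using poly_parity_poly_minus[of k "-1"] by (simp add: poly_parity_poly_minus_1 flip: power_add mult_2)

lemma coeff_pochhammer_linear:
  "coeff (pochhammer [:0, c:] n) 0 = (if n = 0 then 1 else 0 :: real)"
  "coeff (pochhammer [:0, c:] n) 1 = (if n = 0 then 0 else c * fact (n - 1) :: real)"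
proof -
  show "coeff (pochhammer [:0, c:] n) 0 = (if n = 0 then 1 else 0 :: real)"
    by (simp add: poly_0_coeff_0[symmetric] poly_pochhammer pochhammer_0_left)
  have "coeff (pochhammer ([:0, c:] + 1) m) 0 = fact m" for m
    by (simp add: poly_0_coeff_0[symmetric] poly_pochhammer pochhammer_fact)
  thus "coeff (pochhammer [:0, c:] n) 1 = (if n = 0 then 0 else c * fact (n - 1) :: real)"
    by (cases n) (simp_all add: pochhammer_rec coeff_mult)
qed

text \<open>A rising factorial of positive length vanishes at s = 0, so only the extreme indices i =
  0 and i = k contribute to the linear term. Their slopes -1/2 and 1/2, together with the sign
  (-1)^k at i = 0, give 1 - (-1)^k.\<close>

lemma coeff_parity_poly_1:
  "coeff (parity_poly k) 1 = (if k = 0 then 0 else fact (k - 1) * (1 - (-1) ^ k) / (2 * pochhammer (1/2) k * fact k))"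
proof -
  define c where "c i = 1 / (pochhammer (1/2) i * fact i :: real)" for i
  define t where "t i = smult (c i * ((-1) ^ (k - i) * c (k - i))) (pochhammer [:0, 1/2:] i * pochhammer [:0, -1/2:] (k - i))" for i
  have "parity_poly k = (\<Sum>i=0..k. t i)"
    by (rule poly_eq_poly_eq_iff[THEN iffD1, OF ext])
       (simp add: poly_parity_poly_fps fps_mult_nth kummer_fps_def kummer_fps_neg_def c_def t_def poly_sum poly_pochhammer mult_ac)
  hence "coeff (parity_poly k) 1 = (\<Sum>i=0..k. coeff (t i) 1)" by (simp add: coeff_sum)
  also have "\<dots> = (\<Sum>i\<in>{0..k}. (if i = 0 then coeff (t 0) 1 else 0) + (if i = k \<and> k > 0 then coeff (t k) 1 else 0))"
    by (intro sum.cong refl) (auto simp: t_def coeff_mult coeff_pochhammer_linear coeff_pochhammer_linear[unfolded One_nat_def])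
  also have "\<dots> = (if k = 0 then 0 else coeff (t 0) 1 + coeff (t k) 1)"
    by (auto simp: sum.distrib t_def)
  also have "\<dots> = (if k = 0 then 0 else fact (k - 1) * (1 - (-1) ^ k) / (2 * pochhammer (1/2) k * fact k))"
    by (auto simp: t_def c_def coeff_pochhammer_linear coeff_pochhammer_linear[unfolded One_nat_def] field_simps)
  finally show ?thesis .
qed

section \<open>The transformation of the logarithm of the eta function\<close>

lemma sinh_product_formula:
  fixes x :: real
  assumes "x \<noteq> 0"
  shows "(\<lambda>n. \<Prod>k<n. 1 + x\<^sup>2 / (pi\<^sup>2 * real (Suc k) ^ 2)) \<longlonglongrightarrow> sinh x / x"
proof -
  \<comment> \<open>At this point sin (pi z) = i sinh x and -z^2 / k^2 = x^2 / (pi^2 k^2).\<close>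
  define z where "z = \<i> * of_real (x / pi)"
  have "(\<lambda>n. of_real pi * z * (\<Prod>k=1..n. 1 - z^2 / of_nat k^2)) \<longlonglongrightarrow> sin (of_real pi * z)"
    by (rule sin_product_formula_complex)
  also have "sin (of_real pi * z) = \<i> * of_real (sinh x)"
    by (simp add: z_def sin_i_times sinh_field_def exp_minus exp_of_real flip: of_real_minus)
  also have "(\<lambda>n. of_real pi * z * (\<Prod>k=1..n. 1 - z^2 / of_nat k^2)) =
     (\<lambda>n. \<i> * of_real (x * (\<Prod>k<n. 1 + x\<^sup>2 / (pi\<^sup>2 * real (Suc k) ^ 2))))"
  proof
    fix n
    have "(\<Prod>k=1..n. 1 - z^2 / of_nat k^2) = (\<Prod>k<n. 1 - z^2 / of_nat (Suc k)^2)"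
      by (rule prod.reindex_bij_witness[of _ Suc "\<lambda>k. k - 1"]) auto
    also have "\<dots> = of_real (\<Prod>k<n. 1 + x\<^sup>2 / (pi\<^sup>2 * real (Suc k) ^ 2))"
      unfolding of_real_prod by (intro prod.cong) (auto simp: z_def power_mult_distrib power_divide)
    finally show "of_real pi * z * (\<Prod>k=1..n. 1 - z^2 / of_nat k^2) =
       \<i> * of_real (x * (\<Prod>k<n. 1 + x\<^sup>2 / (pi\<^sup>2 * real (Suc k) ^ 2)))"
      by (simp add: z_def)
  qed
  finally have "(\<lambda>n. Im (\<i> * of_real (x * (\<Prod>k<n. 1 + x\<^sup>2 / (pi\<^sup>2 * real (Suc k) ^ 2)))))
      \<longlonglongrightarrow> Im (\<i> * of_real (sinh x))"
    by (rule tendsto_Im)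
  moreover have "Im (\<i> * of_real r) = r" for r by simp
  ultimately have "(\<lambda>n. x * (\<Prod>k<n. 1 + x\<^sup>2 / (pi\<^sup>2 * real (Suc k) ^ 2))) \<longlonglongrightarrow> sinh x"
    by (simp only:)
  from tendsto_divide[OF this tendsto_const[of x]] assms show ?thesis by simp
qed

lemma ln_sinh_over_self_sums:
  fixes x :: real
  assumes "x > 0"
  shows "(\<lambda>k. ln (1 + x\<^sup>2 / (pi\<^sup>2 * real (Suc k) ^ 2))) sums ln (sinh x / x)"
proof -
  have "(\<lambda>n. ln (\<Prod>k<n. 1 + x\<^sup>2 / (pi\<^sup>2 * real (Suc k) ^ 2))) \<longlonglongrightarrow> ln (sinh x / x)"
    using assms by (intro tendsto_ln sinh_product_formula) (auto simp: sinh_real_zero_iff)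
  also have "(\<lambda>n. ln (\<Prod>k<n. 1 + x\<^sup>2 / (pi\<^sup>2 * real (Suc k) ^ 2))) =
     (\<lambda>n. \<Sum>k<n. ln (1 + x\<^sup>2 / (pi\<^sup>2 * real (Suc k) ^ 2)))"
    by (intro ext ln_prod) (auto simp: add_nonneg_eq_0_iff)
  finally show ?thesis by (simp add: sums_def)
qed

text \<open>Logarithmic derivative of the product for sinh x / x, taken term by term.\<close>

lemma coth_partial_fractions:
  fixes x :: real
  assumes "x > 0"
  shows "(\<lambda>k. 2 * x / (x\<^sup>2 + pi\<^sup>2 * real (Suc k) ^ 2)) sums (cosh x / sinh x - 1 / x)"
proof -
  \<comment> \<open>The upper end keeps x in the interior while bounding the numerator 2 t, which
    the Weierstrass majorant needs.\<close>
  define S where "S = {0<..<x + 1}"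
  define f where "f k t = ln (1 + t\<^sup>2 / (pi\<^sup>2 * real (Suc k) ^ 2))" for k t
  define f' where "f' k t = 2 * t / (t\<^sup>2 + pi\<^sup>2 * real (Suc k) ^ 2)" for k t
  have sq: "summable (\<lambda>k. 1 / real (Suc k) ^ 2)"
    using inverse_power_summable[of 2, where ?'a=real] summable_Suc_iff[of "\<lambda>n. inverse (real n ^ 2)"]
    by (simp add: field_simps)
  have unif: "uniformly_convergent_on S (\<lambda>n x. \<Sum>i<n. f' i x)"
  proof (rule Weierstrass_m_test'_ev[OF always_eventually])
    show "summable (\<lambda>k. 2 * (x + 1) / pi\<^sup>2 * (1 / real (Suc k) ^ 2))"
      by (intro summable_mult sq)
    show "\<forall>n. \<forall>t\<in>S. norm (f' n t) \<le> 2 * (x + 1) / pi\<^sup>2 * (1 / real (Suc n) ^ 2)"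
    proof (intro allI ballI)
      fix n t assume "t \<in> S"
      hence t: "0 < t" "t < x + 1" by (auto simp: S_def)
      have "norm (f' n t) = 2 * t / (t\<^sup>2 + pi\<^sup>2 * real (Suc n) ^ 2)"
        using t by (simp add: f'_def)
      also have "\<dots> \<le> 2 * (x + 1) / (pi\<^sup>2 * real (Suc n) ^ 2)"
        using t by (intro frac_le) auto
      finally show "norm (f' n t) \<le> 2 * (x + 1) / pi\<^sup>2 * (1 / real (Suc n) ^ 2)" by simp
    qed
  qed
  have der: "(f k has_field_derivative f' k t) (at t within S)" if "t \<in> S" for k t
  proof -
    have pos: "1 + t\<^sup>2 / (pi\<^sup>2 * real (Suc k) ^ 2) > 0" by (intro add_pos_nonneg) auto
    have "(f k has_field_derivative (2 * t / (pi\<^sup>2 * real (Suc k) ^ 2)) / (1 + t\<^sup>2 / (pi\<^sup>2 * real (Suc k) ^ 2))) (at t within S)"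
      unfolding f_def using pos by (auto intro!: derivative_eq_intros)
    also have "(2 * t / (pi\<^sup>2 * real (Suc k) ^ 2)) / (1 + t\<^sup>2 / (pi\<^sup>2 * real (Suc k) ^ 2)) = f' k t"
    proof -
      have "pi\<^sup>2 * real (Suc k) ^ 2 > 0" by simp
      thus ?thesis unfolding f'_def by (simp add: field_simps)
    qed
    finally show ?thesis .
  qed
  have int: "x \<in> interior S" using assms by (auto simp: S_def interior_open)
  have sm: "summable (\<lambda>n. f n x)"
    using ln_sinh_over_self_sums[OF assms] by (auto simp: f_def sums_iff)
  have D: "((\<lambda>x. \<Sum>n. f n x) has_field_derivative (\<Sum>n. f' n x)) (at x)"
    by (rule has_field_derivative_series'(2)[OF _ der unif _ sm int])
       (use assms in \<open>auto simp: S_def\<close>)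
  have "eventually (\<lambda>t. t \<in> {0<..}) (nhds x)"
    by (rule eventually_nhds_in_open) (use assms in auto)
  hence ev: "eventually (\<lambda>t. (\<Sum>n. f n t) = ln (sinh t / t)) (nhds x)"
    by eventually_elim (use ln_sinh_over_self_sums in \<open>auto simp: f_def sums_iff\<close>)
  from D ev have "((\<lambda>t. ln (sinh t / t)) has_field_derivative (\<Sum>n. f' n x)) (at x)"
    using DERIV_cong_ev[OF refl ev refl] by simp
  moreover have "((\<lambda>t. ln (sinh t / t)) has_field_derivative (cosh x / sinh x - 1 / x)) (at x)"
    using assms
    by (auto intro!: derivative_eq_intros simp: field_simps power2_eq_square)
  ultimately have eq: "(\<Sum>n. f' n x) = cosh x / sinh x - 1 / x"
    by (rule DERIV_unique)
  have "summable (\<lambda>n. f' n x)"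
  proof (rule summable_comparison_test[OF exI[of _ 0]])
    show "summable (\<lambda>k. 2 * x / pi\<^sup>2 * (1 / real (Suc k) ^ 2))"
      by (intro summable_mult sq)
    show "\<forall>n\<ge>0. norm (f' n x) \<le> 2 * x / pi\<^sup>2 * (1 / real (Suc n) ^ 2)"
    proof (intro allI impI)
      fix n :: nat
      have "norm (f' n x) = 2 * x / (x\<^sup>2 + pi\<^sup>2 * real (Suc n) ^ 2)"
        using assms by (simp add: f'_def)
      also have "\<dots> \<le> 2 * x / (pi\<^sup>2 * real (Suc n) ^ 2)"
        using assms by (intro frac_le) auto
      finally show "norm (f' n x) \<le> 2 * x / pi\<^sup>2 * (1 / real (Suc n) ^ 2)" by simp
    qed
  qed
  with eq show ?thesis by (simp add: f'_def sums_iff)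
qed

text \<open>coth x = 1 + 2 / (exp (2 x) - 1), which brings the expansion to the shape of a Lambert
  series term.\<close>

lemma inverse_exp_minus_one_partial_fractions:
  fixes x :: real
  assumes "x > 0"
  shows "(\<lambda>k. x / (x\<^sup>2 + pi\<^sup>2 * real (Suc k) ^ 2)) sums (1 / (exp (2 * x) - 1) + 1 / 2 - 1 / (2 * x))"
proof -
  have e: "exp (2 * x) = exp x * exp x" by (simp flip: exp_add)
  have g: "exp x > 1" using assms by simp
  have g2: "exp x * exp x > 1" using g by (metis less_1_mult)
  have "cosh x = (exp x * exp x + 1) / (2 * exp x)" "sinh x = (exp x * exp x - 1) / (2 * exp x)"
    by (simp_all add: cosh_field_def sinh_field_def exp_minus field_simps)
  hence "cosh x / sinh x = (exp x * exp x + 1) / (exp x * exp x - 1)" by simp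
  also have "\<dots> = 2 / (exp (2 * x) - 1) + 1"
    using g2 unfolding e[symmetric] by (simp add: divide_simps)
  finally have c: "cosh x / sinh x - 1 / x = 2 * (1 / (exp (2 * x) - 1) + 1 / 2 - 1 / (2 * x))"
    by (simp add: field_simps)
  define y where "y = 1 / (exp (2 * x) - 1) + 1 / 2 - 1 / (2 * x)"
  have "(\<lambda>k. 2 * (x / (x\<^sup>2 + pi\<^sup>2 * real (Suc k) ^ 2))) sums (2 * y)"
    using coth_partial_fractions[OF assms] unfolding c y_def[symmetric] by simp
  from sums_mult_D[OF this] show ?thesis unfolding y_def[symmetric] by simp
qed

section \<open>Riemann sums and the integral of arctan t / t\<close>

lemma riemann_sum_tendsto_integral:
  fixes h :: "real \<Rightarrow> real"
  assumes "continuous_on {0..c} h" and "c > 0"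
  shows "(\<lambda>M. \<Sum>m<M. c / real M * h (c * real (Suc m) / real M)) \<longlonglongrightarrow> integral {0..c} h"
proof (rule LIMSEQ_I)
  fix e :: real assume "e > 0"
  define J where "J x = integral {0..x} h" for x
  have dJ: "(J has_real_derivative h t) (at t within {0..c})" if "t \<in> {0..c}" for t
    unfolding J_def by (rule integral_has_real_derivative[OF assms(1) that])
  have "uniformly_continuous_on {0..c} h"
    by (rule compact_uniformly_continuous[OF assms(1)]) simp
  \<comment> \<open>With this tolerance each of the M cells of length c / M contributes an error of
    at most e / (2 M), in total e / 2.\<close>
  moreover have "e / (2 * c) > 0" using \<open>e > 0\<close> assms by simp
  ultimately obtain d where d: "d > 0"
    "\<And>s t. s \<in> {0..c} \<Longrightarrow> t \<in> {0..c} \<Longrightarrow> dist s t < d \<Longrightarrow> dist (h s) (h t) < e / (2 * c)"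
    unfolding uniformly_continuous_on_def by metis
  obtain M0 where M0: "c / d < real M0" using reals_Archimedean2 by blast
  have "norm ((\<Sum>m<M. c / real M * h (c * real (Suc m) / real M)) - J c) < e" if M: "M \<ge> Suc M0" for M
  proof -
    define p where "p m = c * real m / real M" for m
    have Mpos: "real M > 0" using M by simp
    have cM: "c / real M < d"
    proof -
      have "c / d < real M" using M0 M by simp
      thus ?thesis using d(1) Mpos by (simp add: field_simps)
    qed
    have step: "\<bar>c / real M * h (p (Suc m)) - (J (p (Suc m)) - J (p m))\<bar> \<le> c / real M * (e / (2 * c))"
      if "m < M" for m
    proof -
      have p: "0 \<le> p m" "p m \<le> p (Suc m)" "p (Suc m) \<le> c" "p (Suc m) - p m = c / real M"
        using that assms Mpos mult_left_mono[of "real (Suc m)" "real M" c]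
        by (auto simp: p_def field_simps)
      have "\<exists>x\<in>{p m..p (Suc m)}. J (p (Suc m)) - J (p m) = (\<lambda>y. h x * y) (p (Suc m) - p m)"
      proof (rule mvt_very_simple[OF p(2)])
        fix x assume "p m \<le> x" "x \<le> p (Suc m)"
        hence "(J has_real_derivative h x) (at x within {p m..p (Suc m)})"
          using p by (intro DERIV_subset[OF dJ]) auto
        thus "(J has_derivative (\<lambda>y. h x * y)) (at x within {p m..p (Suc m)})"
          by (simp add: has_field_derivative_def)
      qed
      then obtain x where x: "x \<in> {p m..p (Suc m)}" "J (p (Suc m)) - J (p m) = h x * (c / real M)"
        using p(4) by auto
      have "dist (h (p (Suc m))) (h x) < e / (2 * c)"
        using x p cM by (intro d(2)) (auto simp: dist_real_def)
      hence "\<bar>h (p (Suc m)) - h x\<bar> \<le> e / (2 * c)" by (simp add: dist_real_def)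
      moreover have "c / real M * h (p (Suc m)) - (J (p (Suc m)) - J (p m)) = c / real M * (h (p (Suc m)) - h x)"
        by (simp add: x(2) algebra_simps)
      moreover have "c / real M > 0" using assms(2) Mpos by simp
      ultimately show ?thesis by (simp only: abs_mult abs_of_pos mult_left_mono less_imp_le)
    qed
    have "(\<Sum>m<M. J (p (Suc m)) - J (p m)) = J (p M) - J (p 0)"
      by (rule sum_lessThan_telescope)
    hence "J c = (\<Sum>m<M. J (p (Suc m)) - J (p m))"
      using Mpos by (simp add: p_def J_def)
    hence "\<bar>(\<Sum>m<M. c / real M * h (p (Suc m))) - J c\<bar> =
       \<bar>\<Sum>m<M. c / real M * h (p (Suc m)) - (J (p (Suc m)) - J (p m))\<bar>"
      by (simp add: sum_subtractf)
    also have "\<dots> \<le> (\<Sum>m<M. c / real M * (e / (2 * c)))"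
      by (rule order.trans[OF sum_abs]) (intro sum_mono step, simp)
    also have "\<dots> = e / 2" using Mpos assms(2) by simp
    also have "\<dots> < e" using \<open>e > 0\<close> by simp
    finally show ?thesis by (simp add: p_def)
  qed
  thus "\<exists>no. \<forall>n\<ge>no. norm ((\<Sum>m<n. c / real n * h (c * real (Suc m) / real n)) - integral {0..c} h) < e"
    by (auto simp: J_def)
qed

text \<open>The continuous extension to 0 makes the Riemann sum limit applicable on the closed
  interval.\<close>

definition arctanc :: "real \<Rightarrow> real" where
  "arctanc t = (if t = 0 then 1 else arctan t / t)"

lemma continuous_on_arctanc: "continuous_on A arctanc"
proof -
  have "isCont arctanc t" for t
  proof (cases "t = 0")
    case True
    have "(\<lambda>y. (arctan y - arctan 0) / (y - 0)) \<midarrow>0\<rightarrow> inverse (1 + 0\<^sup>2)"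
      using DERIV_arctan[of 0] by (simp only: has_field_derivative_iff)
    hence "(\<lambda>y. arctan y / y) \<midarrow>0\<rightarrow> 1" by simp
    moreover have "eventually (\<lambda>y. arctan y / y = arctanc y) (at 0)"
      by (auto simp: arctanc_def eventually_at intro: exI[of _ 1])
    ultimately have "arctanc \<midarrow>0\<rightarrow> 1" by (rule Lim_transform_eventually)
    thus ?thesis using True by (simp add: isCont_def arctanc_def)
  next
    case False
    have "isCont (\<lambda>t. arctan t / t) t" using False by (intro continuous_intros) auto
    moreover have "eventually (\<lambda>y. arctanc y = arctan y / y) (nhds t)"
      using t1_space_nhds[of t 0] False by (auto simp: arctanc_def elim!: eventually_mono)
    ultimately show ?thesis by (subst isCont_cong)
  qed
  thus ?thesis by (simp add: continuous_at_imp_continuous_on)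
qed

lemma arctan_sum_tendsto:
  assumes "c > 0"
  shows "(\<lambda>M. \<Sum>m<M. arctan (c * real (Suc m) / real M) / real (Suc m)) \<longlonglongrightarrow> integral {0..c} arctanc"
proof -
  have "(\<Sum>m<M. c / real M * arctanc (c * real (Suc m) / real M)) =
        (\<Sum>m<M. arctan (c * real (Suc m) / real M) / real (Suc m))" for M
    by (intro sum.cong refl) (use assms in \<open>auto simp: arctanc_def simp del: of_nat_Suc\<close>)
  with riemann_sum_tendsto_integral[OF continuous_on_arctanc assms] show ?thesis by simp
qed

text \<open>The derivative in c is (arctan c + arctan (1/c)) / c = pi / (2 c), and the difference
  vanishes at c = 1.\<close>

lemma integral_arctanc_diff:
  assumes "c > 0"
  shows "integral {0..c} arctanc - integral {0..1/c} arctanc = pi / 2 * ln c"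
proof -
  define J where "J x = integral {0..x} arctanc" for x
  have dJ: "(J has_real_derivative arctan t / t) (at t)" if "t > 0" for t
  proof -
    have "(J has_real_derivative arctanc t) (at t within {0..t + 1})"
      unfolding J_def using that by (intro integral_has_real_derivative continuous_on_arctanc) auto
    hence "(J has_real_derivative arctanc t) (at t within {0<..<t + 1})"
      by (rule DERIV_subset) auto
    thus ?thesis using that by (simp add: at_within_open[of _ "{0<..<t+1}"] arctanc_def)
  qed
  have "\<exists>k. \<forall>x\<in>{0<..}. J x - J (1 / x) - pi / 2 * ln x = k"
  proof (intro has_field_derivative_zero_constant ballI)
    fix x :: real assume "x \<in> {0<..}"
    hence x: "x > 0" by simp
    have "((\<lambda>x. J (1 / x)) has_real_derivative arctan (1 / x) / (1 / x) * (- 1 / x\<^sup>2)) (at x)"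
      by (rule DERIV_chain'[OF _ dJ]) (use x in \<open>auto intro!: derivative_eq_intros simp: power2_eq_square\<close>)
    hence "((\<lambda>x. J x - J (1 / x) - pi / 2 * ln x) has_real_derivative
        (arctan x / x - arctan (1 / x) / (1 / x) * (- 1 / x\<^sup>2) - pi / 2 * (1 / x))) (at x)"
      using x by (auto intro!: derivative_eq_intros dJ)
    also have "arctan (1 / x) = pi / 2 - arctan x"
      using arctan_inverse[of x] x by (simp add: inverse_eq_divide)
    also have "arctan x / x - (pi / 2 - arctan x) / (1 / x) * (- 1 / x\<^sup>2) - pi / 2 * (1 / x) = 0"
      using x by (simp add: field_simps power2_eq_square)
    finally show "((\<lambda>x. J x - J (1 / x) - pi / 2 * ln x) has_real_derivative 0) (at x within {0<..})"
      by (rule has_field_derivative_at_within)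
  qed simp
  then obtain k where k: "\<And>x. x > 0 \<Longrightarrow> J x - J (1 / x) - pi / 2 * ln x = k" by auto
  from k[of 1] have "k = 0" by simp
  with k[OF assms] show ?thesis by (simp add: J_def)
qed

text \<open>Integral comparison for the tail k > M: the integral of 1 / (\<alpha>^2 + y^2) from M to
  infinity is arctan (\<alpha> / M) / \<alpha>.\<close>

lemma arctan_tail_bounds:
  fixes \<alpha> :: real
  assumes "\<alpha> > 0" and "M > 0" and "(\<lambda>k. 1 / (\<alpha>\<^sup>2 + real (Suc (k + M)) ^ 2)) sums t"
  shows "t \<le> arctan (\<alpha> / real M) / \<alpha>" and "arctan (\<alpha> / real M) / \<alpha> - 1 / real M ^ 2 \<le> t"
proof -
  \<comment> \<open>The tail integral as a function of its lower end: its derivative is -1 /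
    (\<alpha>^2 + y^2) and it tends to 0 at infinity, so its increments telescope to
    \<open>u (real M)\<close>.\<close>
  define u where "u y = arctan (\<alpha> / y) / \<alpha>" for y
  have bound: "1 / (\<alpha>\<^sup>2 + real (Suc k) ^ 2) \<le> u (real k) - u (real (Suc k))"
              "u (real k) - u (real (Suc k)) \<le> 1 / (\<alpha>\<^sup>2 + real k ^ 2)" if "k > 0" for k
  proof -
    have "\<exists>z. z > real k \<and> z < real (Suc k) \<and> u (real (Suc k)) - u (real k) = (real (Suc k) - real k) * (- 1 / (\<alpha>\<^sup>2 + z\<^sup>2))"
    proof (rule MVT2)
      fix y assume y: "real k \<le> y" "y \<le> real (Suc k)"
      have y0: "y > 0" using y that by linarith
      have "(u has_real_derivative (inverse (1 + (\<alpha> / y)\<^sup>2) * (- \<alpha> / y\<^sup>2)) / \<alpha>) (at y)"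
        unfolding u_def using y0 assms(1) by (auto intro!: derivative_eq_intros simp: power2_eq_square)
      also have "(inverse (1 + (\<alpha> / y)\<^sup>2) * (- \<alpha> / y\<^sup>2)) / \<alpha> = - 1 / (\<alpha>\<^sup>2 + y\<^sup>2)"
      proof -
        have "1 + (\<alpha> / y)\<^sup>2 = (\<alpha>\<^sup>2 + y\<^sup>2) / y\<^sup>2" using y0 by (simp add: field_simps)
        moreover have "\<alpha>\<^sup>2 + y\<^sup>2 > 0" using y0 by (simp add: add_nonneg_pos)
        moreover have "(inverse (s / y\<^sup>2) * (- \<alpha> / y\<^sup>2)) / \<alpha> = - 1 / s" if "s > 0" for s
          using that y0 assms(1) by (simp add: field_simps)
        ultimately show ?thesis by simp
      qed
      finally show "(u has_real_derivative - 1 / (\<alpha>\<^sup>2 + y\<^sup>2)) (at y)" .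
    qed simp
    then obtain z where z: "real k < z" "z < real (Suc k)" "u (real k) - u (real (Suc k)) = 1 / (\<alpha>\<^sup>2 + z\<^sup>2)"
      by (auto simp: algebra_simps)
    have "real k ^ 2 \<le> z ^ 2" "z ^ 2 \<le> real (Suc k) ^ 2"
      using z by (auto intro!: power_mono)
    moreover have "\<alpha>\<^sup>2 > 0" using assms(1) by simp
    ultimately show "1 / (\<alpha>\<^sup>2 + real (Suc k) ^ 2) \<le> u (real k) - u (real (Suc k))"
        "u (real k) - u (real (Suc k)) \<le> 1 / (\<alpha>\<^sup>2 + real k ^ 2)"
      unfolding z(3) by (intro divide_left_mono mult_pos_pos add_pos_nonneg; simp)+
  qed
  have "(\<lambda>k. \<alpha> / real (k + M)) \<longlonglongrightarrow> 0"
    by (rule LIMSEQ_ignore_initial_segment) (rule lim_const_over_n)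
  hence "(\<lambda>k. u (real (k + M))) \<longlonglongrightarrow> arctan 0 / \<alpha>"
    unfolding u_def using assms(1) by (intro tendsto_intros) auto
  hence tel: "(\<lambda>k. u (real (k + M)) - u (real (Suc k + M))) sums u (real M)"
    using telescope_sums'[of "\<lambda>k. u (real (k + M))" 0] by simp
  have "t \<le> u (real M)"
    by (rule sums_le[OF _ assms(3) tel]) (use bound(1)[of "_ + M"] assms(2) in auto)
  thus "t \<le> arctan (\<alpha> / real M) / \<alpha>" by (simp add: u_def)
  \<comment> \<open>The lower bound compares with the series started one index earlier; the
    additional first term causes the loss 1 / M^2.\<close>
  have s2: "(\<lambda>k. 1 / (\<alpha>\<^sup>2 + real (k + M) ^ 2)) sums (t + 1 / (\<alpha>\<^sup>2 + real M ^ 2))"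
    using sums_Suc[of "\<lambda>k. 1 / (\<alpha>\<^sup>2 + real (k + M) ^ 2)" t] assms(3) by simp
  have "u (real M) \<le> t + 1 / (\<alpha>\<^sup>2 + real M ^ 2)"
    by (rule sums_le[OF _ tel s2]) (use bound(2)[of "_ + M"] assms(2) in auto)
  also have "1 / (\<alpha>\<^sup>2 + real M ^ 2) \<le> 1 / real M ^ 2"
    using assms(1,2) by (intro divide_left_mono) (auto intro!: mult_pos_pos add_nonneg_pos)
  finally show "arctan (\<alpha> / real M) / \<alpha> - 1 / real M ^ 2 \<le> t"
    by (simp add: u_def)
qed

text \<open>The coth expansion at x = n a, divided by n = m + 1, with its tail replaced by the
  integral. The error is of order 1 / M^2 uniformly in m, so adding up M rows leaves only 1 /
  M.\<close>

lemma truncated_row_asymptotics: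
  fixes a :: real
  assumes "a > 0" and "M > 0"
  shows "\<bar>(1 / (real (Suc m) * (exp (2 * real (Suc m) * a) - 1)) + 1 / (2 * real (Suc m)) - 1 / (2 * a) * (1 / real (Suc m) ^ 2)
           - (\<Sum>k<M. a / (a\<^sup>2 * real (Suc m) ^ 2 + pi\<^sup>2 * real (Suc k) ^ 2)))
          - 1 / pi * (arctan (a / pi * real (Suc m) / real M) / real (Suc m))\<bar> \<le> a / pi\<^sup>2 / real M ^ 2"
proof -
  define n where "n = real (Suc m)"
  have n: "n > 0" by (simp add: n_def)
  define x where "x = n * a"
  have x: "x > 0" using n assms by (simp add: x_def)
  define R where "R = 1 / (n * (exp (2 * n * a) - 1)) + 1 / (2 * n) - 1 / (2 * a) * (1 / n ^ 2)"
  define f where "f k = a / (a\<^sup>2 * n ^ 2 + pi\<^sup>2 * real (Suc k) ^ 2)" for k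
  have "(\<lambda>k. x / (x\<^sup>2 + pi\<^sup>2 * real (Suc k) ^ 2) / n) sums ((1 / (exp (2 * x) - 1) + 1 / 2 - 1 / (2 * x)) / n)"
    by (rule sums_divide[OF inverse_exp_minus_one_partial_fractions[OF x]])
  also have "(1 / (exp (2 * x) - 1) + 1 / 2 - 1 / (2 * x)) / n = R"
  proof -
    have E: "exp (2 * n * a) = exp (2 * x)" by (simp add: x_def mult_ac)
    have "exp (2 * x) > 1" using x by simp
    thus ?thesis using n assms
      unfolding R_def E by (simp add: x_def add_divide_distrib diff_divide_distrib power2_eq_square mult_ac)
  qed
  also have "(\<lambda>k. x / (x\<^sup>2 + pi\<^sup>2 * real (Suc k) ^ 2) / n) = f"
    using n by (auto simp: f_def x_def power_mult_distrib mult_ac)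
  finally have "f sums R" .
  hence "(\<lambda>k. f (k + M)) sums (R - (\<Sum>k<M. f k))"
    by (simp add: sums_iff_shift')
  hence "(\<lambda>k. pi\<^sup>2 / a * f (k + M)) sums (pi\<^sup>2 / a * (R - (\<Sum>k<M. f k)))"
    by (rule sums_mult)
  also have "(\<lambda>k. pi\<^sup>2 / a * f (k + M)) = (\<lambda>k. 1 / ((x / pi)\<^sup>2 + real (Suc (k + M)) ^ 2))"
  proof
    fix k
    have "(x / pi)\<^sup>2 + real (Suc (k + M)) ^ 2 = (a\<^sup>2 * n ^ 2 + pi\<^sup>2 * real (Suc (k + M)) ^ 2) / pi\<^sup>2"
      by (simp add: x_def field_simps power_mult_distrib del: of_nat_Suc)
    thus "pi\<^sup>2 / a * f (k + M) = 1 / ((x / pi)\<^sup>2 + real (Suc (k + M)) ^ 2)"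
      using assms by (simp add: f_def del: of_nat_Suc)
  qed
  finally have s: "(\<lambda>k. 1 / ((x / pi)\<^sup>2 + real (Suc (k + M)) ^ 2)) sums (pi\<^sup>2 / a * (R - (\<Sum>k<M. f k)))" .
  have "x / pi > 0" using x by simp
  from arctan_tail_bounds[OF this assms(2) s]
  have "\<bar>pi\<^sup>2 / a * (R - (\<Sum>k<M. f k)) - arctan (x / pi / real M) / (x / pi)\<bar> \<le> 1 / real M ^ 2"
    by (simp only: abs_le_iff) (smt (verit) divide_nonneg_nonneg zero_le_power2)
  hence "a / pi\<^sup>2 * \<bar>pi\<^sup>2 / a * (R - (\<Sum>k<M. f k)) - arctan (x / pi / real M) / (x / pi)\<bar> \<le> a / pi\<^sup>2 * (1 / real M ^ 2)"
    using assms by (intro mult_left_mono) auto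
  also have "a / pi\<^sup>2 * \<bar>pi\<^sup>2 / a * (R - (\<Sum>k<M. f k)) - arctan (x / pi / real M) / (x / pi)\<bar> =
     \<bar>a / pi\<^sup>2 * (pi\<^sup>2 / a * (R - (\<Sum>k<M. f k)) - arctan (x / pi / real M) / (x / pi))\<bar>"
    using assms by (simp add: abs_mult)
  also have "a / pi\<^sup>2 * (pi\<^sup>2 / a * (R - (\<Sum>k<M. f k)) - arctan (x / pi / real M) / (x / pi)) =
     (R - (\<Sum>k<M. f k)) - 1 / pi * (arctan (x / pi / real M) / n)"
    using assms n by (simp add: x_def right_diff_distrib power2_eq_square)
  also have "x / pi / real M = a / pi * n / real M" by (simp add: x_def)
  finally show ?thesis unfolding R_def f_def n_def by simp
qed

text \<open>
  With \<open>f(m, k) = a / (m\<^sup>2 a\<^sup>2 + k\<^sup>2 \<pi>\<^sup>2)\<close>, the coth expansions for \<open>a\<close> and \<open>b\<close> are the row and the column sums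
  of the same array. Their difference over the square \<open>m, k \<le> M\<close> consists of two tails, which are Riemann sums
  for \<open>\<integral> arctan t / t\<close> over \<open>[0, a/\<pi>]\<close> and \<open>[0, \<pi>/a]\<close>.
\<close>

lemma lattice_sum_limit:
  fixes a b :: real
  assumes "a > 0" and "b > 0" and ab: "a * b = pi ^ 2"
  defines "R \<equiv> (\<lambda>a m. 1 / (real (Suc m) * (exp (2 * real (Suc m) * a) - 1)) + 1 / (2 * real (Suc m)) - 1 / (2 * a) * (1 / real (Suc m) ^ 2))"
  shows "(\<lambda>M. (\<Sum>m<M. R a m) - (\<Sum>m<M. R b m)) \<longlonglongrightarrow> ln (a / b) / 4"
proof -
  define f where "f a m k = a / (a\<^sup>2 * real (Suc m) ^ 2 + pi\<^sup>2 * real (Suc k) ^ 2)" for a m k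
  define A where "A a M = 1 / pi * (\<Sum>m<M. arctan (a / pi * real (Suc m) / real M) / real (Suc m))" for a M
  have row: "(\<lambda>M. (\<Sum>m<M. R a m) - (\<Sum>m<M. \<Sum>k<M. f a m k) - A a M) \<longlonglongrightarrow> 0" if a: "a > 0" for a
  proof (rule Lim_null_comparison)
    show "(\<lambda>M. a / pi\<^sup>2 / real M) \<longlonglongrightarrow> 0" by (rule lim_const_over_n)
    show "eventually (\<lambda>M. norm ((\<Sum>m<M. R a m) - (\<Sum>m<M. \<Sum>k<M. f a m k) - A a M) \<le> a / pi\<^sup>2 / real M) sequentially"
      using eventually_gt_at_top[of 0]
    proof eventually_elim
      case (elim M)
      have "norm ((\<Sum>m<M. R a m) - (\<Sum>m<M. \<Sum>k<M. f a m k) - A a M) =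
        \<bar>\<Sum>m<M. (R a m - (\<Sum>k<M. f a m k)) - 1 / pi * (arctan (a / pi * real (Suc m) / real M) / real (Suc m))\<bar>"
        by (simp add: A_def sum_subtractf sum_distrib_left del: of_nat_Suc)
      also have "\<dots> \<le> (\<Sum>m<M. a / pi\<^sup>2 / real M ^ 2)"
        by (rule order.trans[OF sum_abs])
           (intro sum_mono, use truncated_row_asymptotics[OF a elim] in \<open>simp add: R_def f_def del: of_nat_Suc\<close>)
      also have "\<dots> = a / pi\<^sup>2 / real M"
        using elim by (simp add: power2_eq_square)
      finally show ?case .
    qed
  qed
  have swap: "(\<Sum>m<M. \<Sum>k<M. f b m k) = (\<Sum>m<M. \<Sum>k<M. f a m k)" for M
  proof -
    have "f b m k = f a k m" for m k
    proof -
      have b: "b = pi\<^sup>2 / a" using ab assms by (simp add: field_simps)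
      have "b\<^sup>2 * real (Suc m) ^ 2 + pi\<^sup>2 * real (Suc k) ^ 2 = (pi\<^sup>2 / a\<^sup>2) * (a\<^sup>2 * real (Suc k) ^ 2 + pi\<^sup>2 * real (Suc m) ^ 2)"
        using assms by (simp add: b field_simps power2_eq_square del: of_nat_Suc)
      moreover have "a\<^sup>2 * real (Suc k) ^ 2 + pi\<^sup>2 * real (Suc m) ^ 2 > 0" using assms by (simp add: add_pos_pos del: of_nat_Suc)
      ultimately show ?thesis
        using assms unfolding f_def by (simp add: b power2_eq_square del: of_nat_Suc)
    qed
    hence "(\<Sum>m<M. \<Sum>k<M. f b m k) = (\<Sum>m<M. \<Sum>k<M. f a k m)" by simp
    also have "\<dots> = (\<Sum>m<M. \<Sum>k<M. f a m k)" by (rule sum.swap)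
    finally show ?thesis .
  qed
  have A: "A a \<longlonglongrightarrow> 1 / pi * integral {0..a / pi} arctanc" if "a > 0" for a
    unfolding A_def by (intro tendsto_intros arctan_sum_tendsto) (use that in auto)
  have "(\<lambda>M. ((\<Sum>m<M. R a m) - (\<Sum>m<M. \<Sum>k<M. f a m k) - A a M) + A a M
          - (((\<Sum>m<M. R b m) - (\<Sum>m<M. \<Sum>k<M. f b m k) - A b M) + A b M)) \<longlonglongrightarrow>
       0 + 1 / pi * integral {0..a / pi} arctanc - (0 + 1 / pi * integral {0..b / pi} arctanc)"
    by (intro tendsto_intros row A assms)
  \<comment> \<open>The two Riemann integrals have reciprocal upper ends, so their difference is (pi
    / 2) ln (a / pi); then (a / pi)^2 = a / b yields the factor 1/4.\<close>
  also have "b / pi = 1 / (a / pi)" using assms by (simp add: field_simps power2_eq_square)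
  also have "0 + 1 / pi * integral {0..a / pi} arctanc - (0 + 1 / pi * integral {0..1 / (a / pi)} arctanc) =
     1 / pi * (integral {0..a / pi} arctanc - integral {0..1 / (a / pi)} arctanc)"
    by (simp add: right_diff_distrib)
  also have "\<dots> = 1 / 2 * ln (a / pi)"
    using assms by (subst integral_arctanc_diff) auto
  also have "\<dots> = ln ((a / pi)\<^sup>2) / 4"
    using assms by (simp add: ln_realpow)
  also have "(a / pi)\<^sup>2 = a / b"
    using assms by (simp add: power_divide flip: ab) (simp add: power2_eq_square)
  finally show ?thesis unfolding swap by (simp add: algebra_simps)
qed

section \<open>Lambert series of \<open>sigma_m1\<close> and the eta relation\<close>

lemma sigma_m1_nonneg: "sigma_m1 n \<ge> 0"
  unfolding sigma_m1_def by (intro sum_nonneg) auto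

lemma sigma_m1_le:
  assumes "n > 0"
  shows "sigma_m1 n \<le> real n"
proof -
  have "sigma_m1 n \<le> (\<Sum>d\<in>{d. d dvd n}. 1)"
    unfolding sigma_m1_def
    by (intro sum_mono) (use assms in \<open>auto dest: dvd_pos_nat\<close>)
  also have "\<dots> = real (card {d. d dvd n})" by simp
  also have "card {d. d dvd n} \<le> card {1..n}"
    by (intro card_mono) (use assms in \<open>auto dest: dvd_imp_le dvd_pos_nat simp: Suc_le_eq\<close>)
  finally show ?thesis by simp
qed

text \<open>Expand 1 / (exp (2 d a) - 1) as a geometric series in m and collect the pairs with d m =
  n. All terms are nonnegative, so convergence of the sum over d already justifies the
  regrouping.\<close>

lemma lambert_series_sigma_m1:
  fixes a :: real
  assumes "a > 0"
  shows "(\<lambda>m. 1 / (real (Suc m) * (exp (2 * real (Suc m) * a) - 1))) sums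
           (\<Sum>n. sigma_m1 (Suc n) * exp (- 2 * real (Suc n) * a))"
proof -
  define P where "P = {n::nat. n > 0}"
  define F where "F = (\<lambda>(d, m). 1 / real d * exp (- 2 * real (d * m) * a))"
  define g where "g d = 1 / (real d * (exp (2 * real d * a) - 1))" for d
  have reidx: "(u has_sum t) P \<longleftrightarrow> ((\<lambda>n. u (Suc n)) has_sum t) UNIV" for u and t :: real
    by (rule has_sum_reindex_bij_witness[of _ Suc "\<lambda>n. n - 1"]) (auto simp: P_def)
  have inner: "((\<lambda>m. F (d, m)) has_sum g d) P" if d: "d \<in> P" for d
  proof -
    define q where "q = exp (- 2 * real d * a)"
    have q: "0 < q" "q < 1" using d assms by (auto simp: q_def P_def)
    have "(\<lambda>m. q ^ m) sums (1 / (1 - q))" by (rule geometric_sums) (use q in auto)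
    hence "(\<lambda>m. q / real d * q ^ m) sums (q / real d * (1 / (1 - q)))" by (rule sums_mult)
    also have "(\<lambda>m. q / real d * q ^ m) = (\<lambda>m. F (d, Suc m))"
      by (auto simp: F_def q_def algebra_simps simp flip: exp_of_nat_mult exp_add)
    also have "q / real d * (1 / (1 - q)) = g d"
    proof -
      have E: "exp (2 * real d * a) = 1 / q" by (simp add: q_def exp_minus inverse_eq_divide)
      show ?thesis unfolding g_def E using q d by (simp add: P_def field_simps)
    qed
    finally have "((\<lambda>m. F (d, Suc m)) has_sum g d) UNIV"
      by (rule sums_nonneg_imp_has_sum) (auto simp: F_def)
    thus ?thesis by (simp add: reidx)
  qed
  have g_nonneg: "g d \<ge> 0" for d using assms by (auto simp: g_def)
  have F_nonneg: "F x \<ge> 0" for x by (auto simp: F_def split: prod.splits)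
  have sg: "g summable_on P"
  proof -
    define q where "q = exp (- 2 * a)"
    have q: "0 < q" "q < 1" using assms by (auto simp: q_def)
    have "summable (\<lambda>m. 1 / (1 - q) * q ^ Suc m)"
      using q by (intro summable_mult) (simp add: summable_geometric)
    hence "summable (\<lambda>m. g (Suc m))"
    proof (rule summable_comparison_test'[of _ 0])
      fix m :: nat
      define N where "N = real (Suc m)"
      have N: "N \<ge> 1" by (simp add: N_def)
      have "q ^ Suc m = exp (- (2 * N * a))"
        unfolding q_def N_def exp_of_nat_mult[symmetric] by (simp add: mult_ac)
      hence e: "exp (2 * N * a) = 1 / q ^ Suc m" by (simp add: exp_minus inverse_eq_divide)
      have qs: "q ^ Suc m \<le> q" using q power_decreasing[of 1 "Suc m" q] by simp
      have "norm (g (Suc m)) = 1 / N * (1 / (exp (2 * N * a) - 1))"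
        using g_nonneg[of "Suc m"] by (simp add: g_def N_def)
      also have "\<dots> \<le> 1 * (1 / (exp (2 * N * a) - 1))"
        using N assms by (intro mult_right_mono) auto
      also have "\<dots> = q ^ Suc m / (1 - q ^ Suc m)"
        unfolding e using q qs by (simp add: divide_simps)
      also have "\<dots> \<le> q ^ Suc m / (1 - q)"
        using q qs by (intro divide_left_mono) (auto intro!: mult_pos_pos simp del: power_Suc)
      finally show "norm (g (Suc m)) \<le> 1 / (1 - q) * q ^ Suc m" by simp
    qed
    hence "(\<lambda>m. g (Suc m)) summable_on UNIV"
      by (rule summable_nonneg_imp_summable_on) (rule g_nonneg)
    thus ?thesis using reidx unfolding summable_on_def by metis
  qed
  have sF: "F summable_on P \<times> P"
    by (rule summable_on_SigmaI[OF inner sg]) (use F_nonneg in auto)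
  then obtain s where s: "(F has_sum s) (P \<times> P)" by (auto simp: summable_on_def)
  have gs: "(g has_sum s) P" by (rule has_sum_Sigma'[OF s inner])
  \<comment> \<open>The pair (d, m) is recorded as (n, d) with n = d m, so that for fixed n the
    index d runs over the divisors of n.\<close>
  define G where "G = (\<lambda>(n::nat, d::nat). 1 / real d * exp (- 2 * real n * a))"
  have Gs: "(G has_sum s) (SIGMA n:P. {d. d dvd n})"
    unfolding G_def
    by (subst has_sum_reindex_bij_witness[of _ "\<lambda>(d, m). (d * m, d)" "\<lambda>(n, d). (d, n div d)" _ F])
       (use s in \<open>auto simp: P_def F_def dvd_def\<close>)
  have "((\<lambda>n. sigma_m1 n * exp (- 2 * real n * a)) has_sum s) P"
  proof (rule has_sum_Sigma'[OF Gs])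
    fix n assume "n \<in> P"
    thus "((\<lambda>d. G (n, d)) has_sum sigma_m1 n * exp (- 2 * real n * a)) {d. d dvd n}"
      by (intro has_sum_finiteI) (auto simp: P_def G_def sigma_m1_def sum_distrib_right)
  qed
  hence "(\<lambda>n. sigma_m1 (Suc n) * exp (- 2 * real (Suc n) * a)) sums s"
    unfolding reidx by (rule has_sum_imp_sums)
  moreover have "(\<lambda>m. g (Suc m)) sums s"
    using gs unfolding reidx by (rule has_sum_imp_sums)
  ultimately show ?thesis unfolding g_def by (simp add: sums_iff)
qed

text \<open>In the difference for a and b the divergent terms 1 / (2 m) cancel, and the terms 1 / (2
  a m^2) sum to pi^2 / (12 a) = b / 12, symmetrically for b.\<close>

lemma eta_transformation:
  fixes a b :: real
  assumes "a > 0" and "b > 0" and "a * b = pi ^ 2"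
  shows "(\<Sum>n. sigma_m1 (Suc n) * exp (- 2 * real (Suc n) * a)) - (\<Sum>n. sigma_m1 (Suc n) * exp (- 2 * real (Suc n) * b))
     = ln (a / b) / 4 + (b - a) / 12"
proof -
  define g where "g a m = 1 / (real (Suc m) * (exp (2 * real (Suc m) * a) - 1))" for a m
  define T where "T a = (\<Sum>n. sigma_m1 (Suc n) * exp (- 2 * real (Suc n) * a))" for a
  define h where "h M = (\<Sum>m<M. 1 / real (Suc m) ^ 2)" for M
  have T: "(\<lambda>M. \<Sum>m<M. g a m) \<longlonglongrightarrow> T a" if "a > 0" for a
    using lambert_series_sigma_m1[OF that] by (simp add: g_def T_def sums_def)
  have h: "h \<longlonglongrightarrow> pi\<^sup>2 / 6"
    using inverse_squares_sums by (simp add: h_def[abs_def] sums_def add.commute)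
  have "(\<lambda>M. ((\<Sum>m<M. g a m) - 1 / (2 * a) * h M) - ((\<Sum>m<M. g b m) - 1 / (2 * b) * h M)) \<longlonglongrightarrow>
      (T a - 1 / (2 * a) * (pi\<^sup>2 / 6)) - (T b - 1 / (2 * b) * (pi\<^sup>2 / 6))"
    by (intro tendsto_intros T h assms)
  moreover have "(\<lambda>M. ((\<Sum>m<M. g a m) - 1 / (2 * a) * h M) - ((\<Sum>m<M. g b m) - 1 / (2 * b) * h M)) \<longlonglongrightarrow> ln (a / b) / 4"
    using lattice_sum_limit[OF assms]
    by (simp add: g_def h_def sum.distrib sum_subtractf sum_distrib_left algebra_simps del: of_nat_Suc)
  ultimately have "(T a - 1 / (2 * a) * (pi\<^sup>2 / 6)) - (T b - 1 / (2 * b) * (pi\<^sup>2 / 6)) = ln (a / b) / 4"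
    by (rule LIMSEQ_unique)
  moreover have "1 / (2 * a) * (pi\<^sup>2 / 6) = b / 12" "1 / (2 * b) * (pi\<^sup>2 / 6) = a / 12"
    using assms(1,2) by (simp_all flip: assms(3))
  ultimately show ?thesis by (simp add: T_def field_simps)
qed

section \<open>Polynomials in the Euler operator\<close>

text \<open>Every d divides 0, and a sum over an infinite set is 0 by convention; hence the power
  series in q may start at index 0.\<close>

lemma sigma_m1_0: "sigma_m1 0 = 0"
  by (simp add: sigma_m1_def)

text \<open>Each factor n comes from one termwise differentiation followed by multiplication with q,
  neither of which destroys convergence inside the unit disc.\<close>

lemma summable_sigma_m1_power:
  fixes q :: real
  assumes "\<bar>q\<bar> < 1"
  shows "summable (\<lambda>n. sigma_m1 n * real n ^ N * q ^ n)"
  using assms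
proof (induction N arbitrary: q)
  case 0
  have "summable (\<lambda>n. diffs (\<lambda>_. 1 :: real) n * \<bar>q\<bar> ^ n)"
    by (rule termdiff_converges[where K = 1]) (use 0 in \<open>auto simp: summable_geometric\<close>)
  hence s: "summable (\<lambda>n. real (Suc n) * \<bar>q\<bar> ^ n)" by (simp add: diffs_def)
  show ?case
  proof (rule summable_comparison_test'[OF s, of 0])
    fix n :: nat
    have "sigma_m1 n \<le> real (Suc n)"
      using sigma_m1_le[of n] by (cases "n = 0") (auto simp: sigma_m1_0)
    thus "norm (sigma_m1 n * real n ^ 0 * q ^ n) \<le> real (Suc n) * \<bar>q\<bar> ^ n"
      by (auto simp: abs_mult power_abs sigma_m1_nonneg simp del: of_nat_Suc intro!: mult_right_mono)
  qed
next
  case (Suc N)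
  have "summable (\<lambda>n. diffs (\<lambda>n. sigma_m1 n * real n ^ N) n * q ^ n)"
    by (rule termdiff_converges[where K = 1]) (use Suc in auto)
  hence "summable (\<lambda>n. q * (diffs (\<lambda>n. sigma_m1 n * real n ^ N) n * q ^ n))" by (rule summable_mult)
  hence "summable (\<lambda>n. sigma_m1 (Suc n) * real (Suc n) ^ Suc N * q ^ Suc n)"
    by (simp add: diffs_def mult_ac)
  thus ?case by (subst (asm) summable_Suc_iff)
qed

definition sigma_powser :: "nat \<Rightarrow> real \<Rightarrow> real" where
  "sigma_powser N q = (\<Sum>n. sigma_m1 n * real n ^ N * q ^ n)"

text \<open>The derivative is described only through q D, which is how it enters the chain rule for
  q = exp (-2 x) and involves no division by q.\<close>

lemma sigma_powser_deriv:
  assumes "\<bar>q\<bar> < 1"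
  shows "\<exists>D. (sigma_powser N has_real_derivative D) (at q) \<and> q * D = sigma_powser (Suc N) q"
proof -
  define D where "D = (\<Sum>n. diffs (\<lambda>n. sigma_m1 n * real n ^ N) n * q ^ n)"
  have "(sigma_powser N has_real_derivative D) (at q)"
    unfolding sigma_powser_def D_def
    by (rule termdiffs_strong'[where K = 1]) (use assms summable_sigma_m1_power in auto)
  moreover have "summable (\<lambda>n. diffs (\<lambda>n. sigma_m1 n * real n ^ N) n * q ^ n)"
    by (rule termdiff_converges[where K = 1]) (use assms summable_sigma_m1_power in auto)
  hence "q * D = (\<Sum>n. q * (diffs (\<lambda>n. sigma_m1 n * real n ^ N) n * q ^ n))"
    unfolding D_def by (rule suminf_mult[symmetric])
  hence "q * D = (\<Sum>n. sigma_m1 (Suc n) * real (Suc n) ^ Suc N * q ^ Suc n)"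
    by (simp add: diffs_def mult_ac)
  hence "q * D = sigma_powser (Suc N) q"
    unfolding sigma_powser_def using suminf_split_head[OF summable_sigma_m1_power[OF assms, of "Suc N"]]
    by (simp add: sigma_m1_0)
  ultimately show ?thesis by blast
qed

definition lambert_moment :: "nat \<Rightarrow> real \<Rightarrow> real" where
  "lambert_moment N x = (\<Sum>n. sigma_m1 (Suc n) * (2 * real (Suc n) * x) ^ N * exp (- 2 * real (Suc n) * x))"

lemma lambert_moment_sums:
  assumes "x > 0"
  shows "(\<lambda>n. sigma_m1 (Suc n) * (2 * real (Suc n) * x) ^ N * exp (- 2 * real (Suc n) * x)) sums
           ((2 * x) ^ N * sigma_powser N (exp (- 2 * x)))"
proof -
  have "(\<lambda>n. sigma_m1 n * real n ^ N * exp (- 2 * x) ^ n) sums sigma_powser N (exp (- 2 * x))"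
    unfolding sigma_powser_def by (rule summable_sums[OF summable_sigma_m1_power]) (use assms in auto)
  hence "(\<lambda>n. sigma_m1 (Suc n) * real (Suc n) ^ N * exp (- 2 * x) ^ Suc n) sums sigma_powser N (exp (- 2 * x))"
    by (subst sums_Suc_iff) (simp add: sigma_m1_0)
  hence "(\<lambda>n. (2 * x) ^ N * (sigma_m1 (Suc n) * real (Suc n) ^ N * exp (- 2 * x) ^ Suc n)) sums
      ((2 * x) ^ N * sigma_powser N (exp (- 2 * x)))" by (rule sums_mult)
  moreover have "(2 * x) ^ N * (sigma_m1 (Suc n) * real (Suc n) ^ N * exp (- 2 * x) ^ Suc n) =
     sigma_m1 (Suc n) * (2 * real (Suc n) * x) ^ N * exp (- 2 * real (Suc n) * x)" for n
    unfolding exp_of_nat_mult[symmetric] by (simp add: power_mult_distrib mult_ac del: of_nat_Suc)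
  ultimately show ?thesis by (simp only:)
qed

text \<open>Termwise this is y d/dy (y^N exp (-y)) = N y^N exp (-y) - y^(N+1) exp (-y); the variable
  x = exp t turns the Euler operator into d/dt.\<close>

lemma lambert_moment_deriv:
  "((\<lambda>t. lambert_moment N (exp t)) has_real_derivative
      real N * lambert_moment N (exp t) - lambert_moment (Suc N) (exp t)) (at t)"
proof -
  have eq: "lambert_moment N (exp t) = (2 * exp t) ^ N * sigma_powser N (exp (- 2 * exp t))" for N t
    using lambert_moment_sums[of "exp t" N] by (simp add: lambert_moment_def sums_iff)
  define q where "q = exp (- 2 * exp t)"
  have q: "\<bar>q\<bar> < 1" by (simp add: q_def)
  from sigma_powser_deriv[OF this, of N] obtain D where
    D: "(sigma_powser N has_real_derivative D) (at q)" "q * D = sigma_powser (Suc N) q" by blast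
  have dq: "((\<lambda>t. exp (- 2 * exp t)) has_real_derivative q * (- 2 * exp t)) (at t)"
    by (auto intro!: derivative_eq_intros simp: q_def)
  have ds: "((\<lambda>t. sigma_powser N (exp (- 2 * exp t))) has_real_derivative (q * (- 2 * exp t)) * D) (at t)"
    using DERIV_chain'[OF dq, of "sigma_powser N" D] D(1) by (simp add: q_def mult_ac)
  have dp: "((\<lambda>t. (2 * exp t) ^ N) has_real_derivative real N * (2 * exp t) ^ N) (at t)"
  proof -
    have "((\<lambda>t. 2 * exp t) has_real_derivative 2 * exp t) (at t)"
      by (auto intro!: derivative_eq_intros)
    from DERIV_power[OF this, of N] show ?thesis by (cases N) simp_all
  qed
  have "((\<lambda>t. (2 * exp t) ^ N * sigma_powser N (exp (- 2 * exp t))) has_real_derivative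
      real N * (2 * exp t) ^ N * sigma_powser N q + (q * (- 2 * exp t)) * D * (2 * exp t) ^ N) (at t)"
    using DERIV_mult[OF dp ds] by (simp add: q_def)
  also have "(q * (- 2 * exp t)) * D * (2 * exp t) ^ N = - ((2 * exp t) ^ Suc N * (q * D))"
    by simp
  finally show ?thesis unfolding D(2) by (simp add: eq q_def mult.assoc)
qed

text \<open>The \<open>j\<close>-th derivative of \<open>t \<mapsto> S(exp t)\<close>.\<close>

definition lambert_deriv :: "nat \<Rightarrow> real \<Rightarrow> real" where
  "lambert_deriv j t = (\<Sum>N\<le>j. (-1) ^ N * real (Stirling j N) * lambert_moment N (exp t))"

text \<open>Differentiating each moment reproduces the recurrence S(j+1, N+1) = (N+1) S(j, N+1) +
  S(j, N) of the Stirling numbers; the index shift is aligned by S(j, j+1) = 0.\<close>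

lemma lambert_deriv_has_derivative:
  "(lambert_deriv j has_real_derivative lambert_deriv (Suc j) t) (at t)"
proof -
  define \<phi> where "\<phi> N = lambert_moment N (exp t)" for N
  have "(lambert_deriv j has_real_derivative
     (\<Sum>N\<le>j. (-1) ^ N * real (Stirling j N) * (real N * \<phi> N - \<phi> (Suc N)))) (at t)"
    unfolding lambert_deriv_def \<phi>_def by (intro DERIV_sum DERIV_cmult lambert_moment_deriv)
  also have "(\<Sum>N\<le>j. (-1) ^ N * real (Stirling j N) * (real N * \<phi> N - \<phi> (Suc N))) =
     (\<Sum>N\<le>j. (-1) ^ N * real (Stirling j N) * real N * \<phi> N) + (\<Sum>N\<le>j. (-1) ^ Suc N * real (Stirling j N) * \<phi> (Suc N))"
    by (simp add: sum.distrib[symmetric] algebra_simps)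
  also have "(\<Sum>N\<le>j. (-1) ^ N * real (Stirling j N) * real N * \<phi> N) =
      (\<Sum>N\<le>Suc j. (-1) ^ N * real (Stirling j N) * real N * \<phi> N)"
    by simp
  also have "\<dots> = (\<Sum>N\<le>j. (-1) ^ Suc N * real (Stirling j (Suc N)) * real (Suc N) * \<phi> (Suc N))"
    by (subst sum.atMost_Suc_shift) simp
  also have "\<dots> + (\<Sum>N\<le>j. (-1) ^ Suc N * real (Stirling j N) * \<phi> (Suc N)) =
     (\<Sum>N\<le>j. (-1) ^ Suc N * real (Stirling (Suc j) (Suc N)) * \<phi> (Suc N))"
    by (simp add: sum.distrib[symmetric] algebra_simps)
  also have "\<dots> = lambert_deriv (Suc j) t"
    unfolding lambert_deriv_def \<phi>_def by (subst sum.atMost_Suc_shift) simp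
  finally show ?thesis .
qed

text \<open>For \<open>g j\<close> the \<open>j\<close>-th derivative of a function \<open>f\<close>, this is \<open>p(-d/dt) f\<close>.\<close>

definition umbral :: "(nat \<Rightarrow> real) \<Rightarrow> real poly \<Rightarrow> real" where
  "umbral g p = (\<Sum>j\<le>degree p. coeff p j * (-1) ^ j * g j)"

lemma umbral_altdef:
  assumes "degree p \<le> n"
  shows "umbral g p = (\<Sum>j\<le>n. coeff p j * (-1) ^ j * g j)"
  unfolding umbral_def by (rule sum.mono_neutral_left) (use assms in \<open>auto simp: coeff_eq_0\<close>)

lemma umbral_0 [simp]: "umbral g 0 = 0"
  by (simp add: umbral_def)

lemma umbral_add: "umbral g (p + q) = umbral g p + umbral g q"
proof -
  define n where "n = max (degree p) (degree q)"
  have "degree p \<le> n" "degree q \<le> n" "degree (p + q) \<le> n"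
    by (auto simp: n_def degree_add_le)
  thus ?thesis by (simp add: umbral_altdef[of _ n] sum.distrib[symmetric] algebra_simps)
qed

lemma umbral_smult: "umbral g (smult c p) = c * umbral g p"
  by (subst umbral_altdef[of _ "degree p"]) (auto simp: degree_smult_le umbral_def sum_distrib_left mult_ac)

lemma umbral_sum: "umbral g (\<Sum>i\<in>I. p i) = (\<Sum>i\<in>I. umbral g (p i))"
  by (induction I rule: infinite_finite_induct) (auto simp: umbral_add)

text \<open>Multiplication by the indeterminate corresponds to -d/dt.\<close>

lemma umbral_pCons_0: "umbral g (pCons 0 p) = - umbral (\<lambda>j. g (Suc j)) p"
proof -
  have "umbral g (pCons 0 p) = (\<Sum>j\<le>Suc (degree p). coeff (pCons 0 p) j * (-1) ^ j * g j)"
    by (rule umbral_altdef) (rule degree_pCons_le)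
  also have "\<dots> = - umbral (\<lambda>j. g (Suc j)) p"
    by (subst sum.atMost_Suc_shift) (simp add: umbral_def sum_negf)
  finally show ?thesis .
qed

text \<open>From (s)_(N+1) = s (s)_N + N (s)_N and s = -d/dt, the moment formula for the derivative
  leaves exactly the next moment. The induction hypothesis is itself differentiated in t, so it must
  hold for all t.\<close>

lemma umbral_lambert_pochhammer:
  "umbral (\<lambda>j. lambert_deriv j t) (pochhammer [:0, 1:] N) = lambert_moment N (exp t)"
proof (induction N arbitrary: t)
  case 0
  show ?case by (simp add: umbral_def lambert_deriv_def)
next
  case (Suc N)
  define p where "p = pochhammer [:0, 1 :: real:] N"
  have "((\<lambda>t. umbral (\<lambda>j. lambert_deriv j t) p) has_real_derivative umbral (\<lambda>j. lambert_deriv (Suc j) t) p) (at t)"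
    unfolding umbral_def by (intro DERIV_sum DERIV_cmult lambert_deriv_has_derivative)
  hence "((\<lambda>t. lambert_moment N (exp t)) has_real_derivative umbral (\<lambda>j. lambert_deriv (Suc j) t) p) (at t)"
    unfolding p_def Suc.IH .
  hence D: "umbral (\<lambda>j. lambert_deriv (Suc j) t) p = real N * lambert_moment N (exp t) - lambert_moment (Suc N) (exp t)"
    using lambert_moment_deriv DERIV_unique by blast
  have "pochhammer [:0, 1 :: real:] (Suc N) = pCons 0 p + smult (real N) p"
    by (simp add: pochhammer_Suc p_def of_nat_poly algebra_simps)
  hence "umbral (\<lambda>j. lambert_deriv j t) (pochhammer [:0, 1:] (Suc N)) =
     - umbral (\<lambda>j. lambert_deriv (Suc j) t) p + real N * umbral (\<lambda>j. lambert_deriv j t) p"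
    by (simp only: umbral_add umbral_smult umbral_pCons_0)
  also have "\<dots> = lambert_moment (Suc N) (exp t)"
    using D by (simp add: p_def Suc.IH)
  finally show ?case .
qed

text \<open>The j-th derivative of the eta relation at a = exp t, b = exp (c - t), where ln (a / b)
  = 2 t - c. The inner derivative -1 of the reflection produces (-1)^j.\<close>

lemma lambert_deriv_transformation:
  fixes t :: real
  defines "c \<equiv> 2 * ln pi"
  shows "lambert_deriv j t - (-1) ^ j * lambert_deriv j (c - t) =
    (if j = 0 then (2 * t - c) / 4 else if j = 1 then 1 / 2 else 0) + ((-1) ^ j * exp (c - t) - exp t) / 12"
proof (induction j arbitrary: t)
  case 0
  have "exp t * exp (c - t) = pi ^ 2"
    by (simp add: c_def exp_double flip: exp_add)
  from eta_transformation[OF _ _ this] have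
    "lambert_moment 0 (exp t) - lambert_moment 0 (exp (c - t)) = ln (exp t / exp (c - t)) / 4 + (exp (c - t) - exp t) / 12"
    by (simp add: lambert_moment_def)
  thus ?case by (simp add: lambert_deriv_def ln_div)
next
  case (Suc j)
  have "((\<lambda>t. lambert_deriv j t - (-1) ^ j * lambert_deriv j (c - t)) has_real_derivative
       lambert_deriv (Suc j) t - (-1) ^ j * (lambert_deriv (Suc j) (c - t) * (0 - 1))) (at t)"
    by (intro DERIV_diff DERIV_cmult lambert_deriv_has_derivative DERIV_chain'[OF _ lambert_deriv_has_derivative] DERIV_const DERIV_ident)
  moreover have "((\<lambda>t. (if j = 0 then (2 * t - c) / 4 else if j = 1 then 1 / 2 else 0) + ((-1) ^ j * exp (c - t) - exp t) / 12)
     has_real_derivative (if Suc j = 1 then 1 / 2 else 0) + ((-1) ^ Suc j * exp (c - t) - exp t) / 12) (at t)"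
    by (cases "j = 0"; cases "j = 1") (auto intro!: derivative_eq_intros)
  ultimately have "lambert_deriv (Suc j) t - (-1) ^ j * (lambert_deriv (Suc j) (c - t) * (0 - 1)) =
      (if Suc j = 1 then 1 / 2 else 0) + ((-1) ^ Suc j * exp (c - t) - exp t) / 12"
    unfolding Suc.IH by (rule DERIV_unique)
  thus ?case by simp
qed

section \<open>Transfer of the eta relation to polynomials with parity\<close>

lemma poly_altdef_le:
  fixes p :: "'a :: comm_semiring_1 poly"
  assumes "degree p \<le> n"
  shows "poly p x = (\<Sum>i\<le>n. coeff p i * x ^ i)"
  unfolding poly_altdef by (rule sum.mono_neutral_left) (use assms in \<open>auto simp: coeff_eq_0\<close>)

lemma umbral_transformation:
  fixes a b :: real
  assumes "a > 0" "b > 0" "a * b = pi ^ 2"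
  assumes parity: "\<And>j. (-1) ^ j * coeff p j = (-1) ^ k * coeff p j"
  shows "umbral (\<lambda>j. lambert_deriv j (ln a)) p - (-1) ^ k * umbral (\<lambda>j. lambert_deriv j (ln b)) p =
     coeff p 0 * ln (a / b) / 4 - coeff p 1 / 2 + (poly p 1 * b - poly p (-1) * a) / 12"
proof -
  \<comment> \<open>One more than the degree, so that the range contains j = 0 and j = 1 even for
    constant p.\<close>
  define n where "n = Suc (degree p)"
  have n: "degree p \<le> n" by (simp add: n_def)
  define c where "c = 2 * ln pi"
  have "ln a + ln b = ln (a * b)" using assms(1,2) by (simp add: ln_mult)
  also have "\<dots> = c" using assms(3) by (simp add: ln_realpow c_def)
  finally have lnb: "ln b = c - ln a" by simp
  define D where "D j = (if j = 0 then (2 * ln a - c) / 4 else if j = 1 then 1 / 2 else 0) + ((-1) ^ j * b - a) / 12" for j :: nat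
  have eb: "exp (c - ln a) = b" using assms by (simp flip: lnb)
  have D: "lambert_deriv j (ln a) = D j + (-1) ^ j * lambert_deriv j (ln b)" for j
    using lambert_deriv_transformation[of j "ln a"] assms unfolding D_def lnb c_def[symmetric] eb by simp
  have "umbral (\<lambda>j. lambert_deriv j (ln a)) p =
      (\<Sum>j\<le>n. coeff p j * (-1) ^ j * D j) + (\<Sum>j\<le>n. (-1) ^ j * ((-1) ^ j * coeff p j) * lambert_deriv j (ln b))"
    unfolding umbral_altdef[OF n] D by (simp add: sum.distrib[symmetric] ring_distribs mult_ac)
  also have "(\<Sum>j\<le>n. (-1) ^ j * ((-1) ^ j * coeff p j) * lambert_deriv j (ln b)) =
      (-1) ^ k * umbral (\<lambda>j. lambert_deriv j (ln b)) p"
    unfolding parity umbral_altdef[OF n] by (simp add: sum_distrib_left mult_ac)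
  \<comment> \<open>The two signs (-1)^j cancel in front of b, which gives p(1); one survives in
    front of a, which gives p(-1). The logarithm touches only the coefficients 0 and 1.\<close>
  also have "(\<Sum>j\<le>n. coeff p j * (-1) ^ j * D j) =
     (\<Sum>j\<le>n. (if j = 0 then coeff p 0 * (2 * ln a - c) / 4 else 0) + (if j = 1 then - coeff p 1 / 2 else 0)
         + (coeff p j * 1 ^ j * (b / 12) - coeff p j * (-1) ^ j * (a / 12)))"
    by (intro sum.cong refl) (auto simp: D_def algebra_simps power_mult_distrib[symmetric] diff_divide_distrib)
  also have "\<dots> = coeff p 0 * (2 * ln a - c) / 4 - coeff p 1 / 2 + (poly p 1 * (b / 12) - poly p (-1) * (a / 12))"
    by (simp add: sum.distrib sum_subtractf poly_altdef_le[OF n] sum_distrib_right sum_divide_distrib n_def del: sum.atMost_Suc power_one)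
  also have "2 * ln a - c = ln (a / b)"
    using assms lnb by (simp add: ln_div)
  finally show ?thesis by (simp add: algebra_simps diff_divide_distrib)
qed

text \<open>The coefficient of z^k in the full sum over n and r, before multiplication by exp
  (-z).\<close>

definition humbert_lambert :: "nat \<Rightarrow> real \<Rightarrow> real" where
  "humbert_lambert k x = (\<Sum>N\<le>k. humbert_coeff k N * lambert_moment N x)"

lemma umbral_parity_poly:
  assumes "x > 0"
  shows "umbral (\<lambda>j. lambert_deriv j (ln x)) (parity_poly k) =
     (\<Sum>j\<le>k. (-1) ^ (k - j) / fact (k - j) * humbert_lambert j x)"
  using assms
  by (simp add: parity_poly_def humbert_poly_def humbert_lambert_def umbral_sum umbral_smult umbral_lambert_pochhammer)

lemma humbert_lambert_transformation:
  fixes a b :: real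
  assumes "a > 0" "b > 0" "a * b = pi ^ 2"
  shows "(\<Sum>j\<le>k. (-1) ^ (k - j) / fact (k - j) * humbert_lambert j a)
         - (-1) ^ k * (\<Sum>j\<le>k. (-1) ^ (k - j) / fact (k - j) * humbert_lambert j b) =
    (if k = 0 then ln (a / b) / 4 else - fact (k - 1) * (1 - (-1) ^ k) / (4 * pochhammer (1/2) k * fact k))
      + (b - (-1) ^ k * a) / (12 * pochhammer (1/2) k)"
proof -
  have "(poly (parity_poly k) 1 * b - poly (parity_poly k) (-1) * a) / 12 = (b - (-1) ^ k * a) / (12 * pochhammer (1/2) k)"
    by (simp add: poly_parity_poly_1 poly_parity_poly_minus_1 diff_divide_distrib)
  moreover have "coeff (parity_poly k) 0 * ln (a / b) / 4 - coeff (parity_poly k) 1 / 2 =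
     (if k = 0 then ln (a / b) / 4 else - fact (k - 1) * (1 - (-1) ^ k) / (4 * pochhammer (1/2) k * fact k))"
    unfolding coeff_parity_poly_1 poly_0_coeff_0[symmetric] poly_parity_poly_0 by auto
  ultimately show ?thesis
    using umbral_transformation[OF assms coeff_parity_poly_parity, of k]
    unfolding umbral_parity_poly[OF assms(1)] umbral_parity_poly[OF assms(2)] by (simp only:)
qed

section \<open>Rearrangement of the Humbert series\<close>

lemma summable_power_over_pochhammer:
  fixes z :: "'a :: {real_normed_field, banach}"
  assumes "c > 0"
  shows "summable (\<lambda>k. norm (z ^ k / of_real (pochhammer c k)))"
proof -
  obtain n where n: "2 * norm z < real n" using reals_Archimedean2 by blast
  have "norm (norm (z ^ Suc k / of_real (pochhammer c (Suc k)))) \<le> 1 / 2 * norm (norm (z ^ k / of_real (pochhammer c k)))"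
    if "k \<ge> n" for k
  proof -
    have pos: "pochhammer c k > 0" "c + real k > 0" using assms by (auto intro: pochhammer_pos)
    have "2 * norm z \<le> c + real k" using n that assms by linarith
    hence "norm z / (c + real k) \<le> 1 / 2" using pos by (simp add: field_simps)
    hence "norm z / (c + real k) * (norm z ^ k / pochhammer c k) \<le> 1 / 2 * (norm z ^ k / pochhammer c k)"
      using pos by (intro mult_right_mono) auto
    thus ?thesis using pos
      by (simp add: pochhammer_Suc norm_divide norm_mult norm_power mult_ac abs_mult del: of_real_add)
  qed
  thus ?thesis by (intro summable_ratio_test[of "1/2"]) auto
qed

lemma power_over_pochhammer_half_bounded:
  fixes A :: real
  obtains C where "C > 0" and "\<And>N. A ^ N / pochhammer (1/2) N \<le> C"
proof -
  have "summable (\<lambda>k. norm (A ^ k / pochhammer (1/2) k))"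
    using summable_power_over_pochhammer[of "1/2" A] by simp
  hence "Bseq (\<lambda>k. A ^ k / pochhammer (1/2) k)"
    by (rule summable_imp_Bseq[OF summable_norm_cancel])
  then obtain C where "C > 0" "\<forall>k. norm (A ^ k / pochhammer (1/2) k) \<le> C"
    by (rule BseqE)
  thus thesis using that[of C] by (metis abs_le_D1 real_norm_def)
qed

text \<open>The summand after expanding \<open>Humbert_Phi3\<close>, with r! (1/2)_r and the power
  4^r merged into (2r)! and the two rising factorials in the denominator merged into one. The type
  is polymorphic so that the value at the real number |z| serves as majorant.\<close>

definition humbert_family :: "'a :: {real_normed_field, banach} \<Rightarrow> real \<Rightarrow> nat \<times> nat \<times> nat \<Rightarrow> 'a" where
  "humbert_family z y = (\<lambda>(r, m, n).
     of_real (pochhammer (1/2) m / (pochhammer (1/2) (2 * r + (m + n)) * (fact m * fact n * fact (2 * r)))) *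
     z ^ (m + (n + 2 * r)) * of_real y ^ (n + 2 * r))"

definition humbert_weight :: "nat \<Rightarrow> real \<Rightarrow> real" where
  "humbert_weight k y = (\<Sum>N\<le>k. humbert_coeff k N * y ^ N)"

lemma norm_humbert_family:
  assumes "y \<ge> 0"
  shows "norm (humbert_family z y x) = humbert_family (norm z) y x"
proof -
  have "pochhammer (1/2 :: real) m \<ge> 0" for m by (rule less_imp_le, rule pochhammer_pos) simp
  thus ?thesis using assms
    by (auto simp: humbert_family_def norm_mult norm_power norm_divide split: prod.splits)
qed

lemma has_sum_exp_real:
  fixes t :: real
  assumes "t \<ge> 0"
  shows "((\<lambda>n. t ^ n / fact n) has_sum exp t) UNIV"
  using exp_converges[of t] assms by (intro sums_nonneg_imp_has_sum) (auto simp: field_simps)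

text \<open>With N = n + 2 r one has (1/2)_(N+m) >= (1/2)_N (1/2)_m, which decouples m. The growth
  of (1/2)_N absorbs any geometric factor, so the rate in y can be made small at the price of C; the
  rate 1/2 stays below the decay rate 1 of exp (-y).\<close>

lemma humbert_family_bound:
  fixes A :: real
  assumes "A \<ge> 0"
  obtains C where "\<And>y. y \<ge> 0 \<Longrightarrow> humbert_family A y summable_on UNIV"
    and "\<And>y. y \<ge> 0 \<Longrightarrow> infsum (humbert_family A y) UNIV \<le> C * exp (y / 2)"
proof -
  obtain C where C: "C > 0" "\<And>N. (4 * A) ^ N / pochhammer (1/2) N \<le> C"
    using power_over_pochhammer_half_bounded[of "4 * A"] by blast
  have "humbert_family A y summable_on UNIV \<and> infsum (humbert_family A y) UNIV \<le> C * exp A * exp (y / 2)"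
    if y: "y \<ge> 0" for y
  proof -
    \<comment> \<open>The sums over n and over r each cost at most exp t, together exp (y/2); the
      compensating factor 4^N is swallowed by (1/2)_N.\<close>
    define t where "t = y / 4"
    have t: "t \<ge> 0" using y by (simp add: t_def)
    define g where "g = (\<lambda>(r, m, n). C * (t ^ (2 * r) / fact (2 * r)) * (A ^ m / fact m) * (t ^ n / fact n))"
    have le: "humbert_family A y x \<le> g x" for x
    proof -
      obtain r m n where x: "x = (r, m, n)" by (metis prod_cases3)
      have pp: "pochhammer (1/2 :: real) j > 0" for j by (rule pochhammer_pos) simp
      define N where "N = n + 2 * r"
      have "pochhammer (1/2 :: real) (2 * r + (m + n)) = pochhammer (1/2) N * pochhammer (1/2 + real N) m"
        using pochhammer_product'[of "1/2 :: real" N m] by (simp add: N_def add_ac)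
      moreover have "pochhammer (1/2 + real N) m \<ge> pochhammer (1/2) m"
        unfolding pochhammer_prod by (intro prod_mono) auto
      ultimately have ge: "pochhammer (1/2 :: real) (2 * r + (m + n)) \<ge> pochhammer (1/2) N * pochhammer (1/2) m"
        using pp[of N] by simp
      have "pochhammer (1/2) m / pochhammer (1/2) (2 * r + (m + n)) \<le> pochhammer (1/2) m / (pochhammer (1/2 :: real) N * pochhammer (1/2) m)"
        using pp ge by (intro divide_left_mono mult_pos_pos) (auto intro: less_imp_le)
      also have "\<dots> = 1 / pochhammer (1/2) N" using pp[of m] by simp
      finally have q: "pochhammer (1/2) m / pochhammer (1/2) (2 * r + (m + n)) \<le> 1 / pochhammer (1/2 :: real) N" .
      have "humbert_family A y x = pochhammer (1/2) m / pochhammer (1/2) (2 * r + (m + n)) *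
             (A ^ (m + N) * y ^ N / (fact m * fact n * fact (2 * r)))"
        by (simp add: humbert_family_def x N_def)
      also have "\<dots> \<le> 1 / pochhammer (1/2) N * (A ^ (m + N) * y ^ N / (fact m * fact n * fact (2 * r)))"
        using y assms by (intro mult_right_mono q) auto
      also have "A ^ (m + N) * y ^ N = A ^ m * ((4 * A) ^ N * t ^ N)"
        by (simp add: t_def power_add power_mult_distrib power_divide)
      also have "1 / pochhammer (1/2) N * (A ^ m * ((4 * A) ^ N * t ^ N) / (fact m * fact n * fact (2 * r))) =
          ((4 * A) ^ N / pochhammer (1/2) N) * (A ^ m * t ^ N / (fact m * fact n * fact (2 * r)))" by simp
      also have "\<dots> \<le> C * (A ^ m * t ^ N / (fact m * fact n * fact (2 * r)))"
        using t assms by (intro mult_right_mono C) auto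
      also have "\<dots> = g x" by (simp add: g_def x N_def power_add mult_ac)
      finally show ?thesis .
    qed
    have nonneg: "humbert_family A y x \<ge> 0" for x
      using norm_humbert_family[OF y, of A x] assms by (metis abs_of_nonneg norm_ge_zero real_norm_def)
    have E: "(\<lambda>r. t ^ (2 * r) / fact (2 * r)) summable_on UNIV"
      "infsum (\<lambda>r. t ^ (2 * r) / fact (2 * r)) UNIV \<le> exp t"
    proof -
      have inj: "inj (\<lambda>r::nat. 2 * r)" by (auto simp: inj_def)
      have s: "(\<lambda>n. t ^ n / fact n) summable_on range (\<lambda>r. 2 * r)"
        using has_sum_exp_real[OF t] by (metis summable_on_def subset_UNIV summable_on_subset_banach)
      thus "(\<lambda>r. t ^ (2 * r) / fact (2 * r)) summable_on UNIV"
        using summable_on_reindex[OF inj, of "\<lambda>n. t ^ n / fact n"] by (simp add: o_def)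
      have "infsum (\<lambda>r. t ^ (2 * r) / fact (2 * r)) UNIV = infsum (\<lambda>n. t ^ n / fact n) (range (\<lambda>r. 2 * r))"
        using infsum_reindex[OF inj, of "\<lambda>n. t ^ n / fact n"] by (simp add: o_def)
      also have "\<dots> \<le> infsum (\<lambda>n. t ^ n / fact n) UNIV"
        by (rule infsum_mono2[OF s]) (use has_sum_exp_real[OF t] t in \<open>auto simp: summable_on_def\<close>)
      also have "\<dots> = exp t" using has_sum_exp_real[OF t] by (rule infsumI)
      finally show "infsum (\<lambda>r. t ^ (2 * r) / fact (2 * r)) UNIV \<le> exp t" .
    qed
    define L where "L = infsum (\<lambda>r. t ^ (2 * r) / fact (2 * r)) UNIV"
    have g_nonneg: "g x \<ge> 0" for x using le[of x] nonneg[of x] by linarith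
    have h1: "((\<lambda>n. g (r, m, n)) has_sum C * (t ^ (2 * r) / fact (2 * r)) * (A ^ m / fact m) * exp t) UNIV" for r m
      unfolding g_def prod.case by (intro has_sum_cmult_right has_sum_exp_real t)
    have h2: "((\<lambda>m. C * (t ^ (2 * r) / fact (2 * r)) * (A ^ m / fact m) * exp t) has_sum
         C * (t ^ (2 * r) / fact (2 * r)) * exp A * exp t) UNIV" for r
      by (intro has_sum_cmult_left has_sum_cmult_right has_sum_exp_real assms)
    have h3: "((\<lambda>r. C * (t ^ (2 * r) / fact (2 * r)) * exp A * exp t) has_sum C * L * exp A * exp t) UNIV"
      unfolding L_def by (intro has_sum_cmult_left has_sum_cmult_right has_sum_infsum E)
    have s2: "(\<lambda>mn. g (r, mn)) summable_on (UNIV \<times> UNIV)" for r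
      by (rule summable_on_SigmaI[OF h1]) (use h2 g_nonneg in \<open>auto simp: summable_on_def\<close>)
    have h23: "((\<lambda>mn. g (r, mn)) has_sum C * (t ^ (2 * r) / fact (2 * r)) * exp A * exp t) (UNIV \<times> UNIV)" for r
      by (rule has_sum_SigmaI[OF h1 h2 s2])
    have s3: "g summable_on (UNIV \<times> (UNIV \<times> UNIV))"
      by (rule summable_on_SigmaI[OF h23]) (use h3 g_nonneg in \<open>auto simp: summable_on_def\<close>)
    have h: "(g has_sum C * L * exp A * exp t) (UNIV \<times> (UNIV \<times> UNIV))"
      by (rule has_sum_SigmaI[OF h23 h3 s3])
    have s: "humbert_family A y summable_on UNIV"
      by (rule summable_on_comparison_test[of g]) (use s3 le nonneg in auto)
    have "infsum (humbert_family A y) UNIV \<le> infsum g UNIV"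
      by (rule infsum_mono[OF s]) (use s3 le in auto)
    also have "\<dots> = C * L * exp A * exp t" using infsumI[OF h] by simp
    also have "\<dots> \<le> C * exp t * exp A * exp t"
      using E(2) C(1) unfolding L_def by (intro mult_right_mono mult_left_mono) auto
    also have "\<dots> = C * exp A * exp (y / 2)"
      by (simp add: t_def mult_ac flip: exp_add)
    finally show ?thesis using s by simp
  qed
  with that show ?thesis by blast
qed

lemma humbert_family_summable:
  assumes "y \<ge> 0"
  shows "humbert_family z y summable_on UNIV"
proof -
  obtain C where "\<And>y. y \<ge> 0 \<Longrightarrow> humbert_family (norm z) y summable_on UNIV"
    using humbert_family_bound[OF norm_ge_zero[of z]] by metis
  hence "(\<lambda>x. norm (humbert_family z y x)) summable_on UNIV"
    using assms by (simp add: norm_humbert_family)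
  thus ?thesis by (rule abs_summable_summable)
qed

text \<open>Grouping by k = m + n + 2 r and N = n + 2 r has finite fibres, and the fibre over k sums
  to a polynomial in y.\<close>

lemma humbert_family_by_degree:
  fixes z :: complex
  assumes "y \<ge> 0"
  shows "((\<lambda>k. z ^ k * of_real (humbert_weight k y)) has_sum infsum (humbert_family z y) UNIV) UNIV"
proof -
  define B where "B k = (SIGMA N:{..k}. {r. 2 * r \<le> N})" for k :: nat
  have fin: "finite {r. 2 * r \<le> N}" for N :: nat
    by (rule finite_subset[of _ "{..N}"]) auto
  define G where "G = (\<lambda>(k, N, r). humbert_family z y (r, k - N, N - 2 * r))"
  have "(humbert_family z y has_sum infsum (humbert_family z y) UNIV) UNIV"
    by (rule has_sum_infsum[OF humbert_family_summable[OF assms]])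
  hence G: "(G has_sum infsum (humbert_family z y) UNIV) (Sigma UNIV B)"
    by (subst has_sum_reindex_bij_witness[of _ "\<lambda>(r, m, n). (m + (n + 2 * r), n + 2 * r, r)"
          "\<lambda>(k, N, r). (r, k - N, N - 2 * r)" UNIV "humbert_family z y"])
       (auto simp: B_def G_def)
  show ?thesis
  proof (rule has_sum_Sigma'[OF G])
    fix k :: nat
    have "(\<Sum>x\<in>B k. G (k, x)) = (\<Sum>N\<le>k. \<Sum>r | 2 * r \<le> N. G (k, N, r))"
      unfolding B_def by (subst sum.Sigma) (auto simp: fin)
    also have "\<dots> = z ^ k * of_real (humbert_weight k y)"
      unfolding humbert_weight_def humbert_coeff_def sum_distrib_left sum_distrib_right of_real_sum
    proof (intro sum.cong refl)
      fix N r assume "N \<in> {..k}" "r \<in> {r. 2 * r \<le> N}"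
      hence *: "2 * r + (k - N + (N - 2 * r)) = k" "k - N + (N - 2 * r + 2 * r) = k" "N - 2 * r + 2 * r = N" "k - N + N = k" by auto
      show "G (k, N, r) = z ^ k * of_real (pochhammer (1/2) (k - N) / (pochhammer (1/2) k * fact (k - N)) *
          (1 / (fact (N - 2 * r) * fact (2 * r))) * y ^ N)"
        unfolding G_def humbert_family_def prod.case * by (simp add: mult_ac)
    qed
    finally show "((\<lambda>x. G (k, x)) has_sum z ^ k * of_real (humbert_weight k y)) (B k)"
      by (intro has_sum_finiteI) (auto simp: B_def fin)
  qed
qed

section \<open>Iterated sums and exchange of summations\<close>

lemma has_sum_iterated:
  fixes f :: "nat \<times> 'b \<Rightarrow> complex"
  assumes "f summable_on UNIV"
  shows "((\<lambda>m. infsum (\<lambda>x. f (m, x)) UNIV) has_sum infsum f UNIV) UNIV"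
    and "(\<lambda>x. f (m, x)) summable_on UNIV"
proof -
  have s: "f summable_on (UNIV \<times> UNIV)" using assms by simp
  have 1: "(\<lambda>x. f (m, x)) summable_on UNIV" for m
  proof -
    have "(\<lambda>(m, x). f (m, x)) summable_on (SIGMA m:UNIV. UNIV)" using s by simp
    thus ?thesis by (rule summable_on_SigmaD1) simp
  qed
  thus "(\<lambda>x. f (m, x)) summable_on UNIV" .
  show "((\<lambda>m. infsum (\<lambda>x. f (m, x)) UNIV) has_sum infsum f UNIV) UNIV"
    by (rule has_sum_Sigma'[where f = f and A = UNIV and B = "\<lambda>_. UNIV"]) (use s 1 in \<open>auto intro: has_sum_infsum\<close>)
qed

text \<open>Convergence of the inner series is available only after multiplication by a prefactor
  that may vanish (for instance at z = 0); for c = 0 both sides are 0 whatever f does.\<close>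

lemma suminf_cmult':
  fixes c :: "'a :: {real_normed_field}"
  assumes "summable (\<lambda>n. c * f n)"
  shows "c * suminf f = (\<Sum>n. c * f n)"
proof (cases "c = 0")
  case False
  hence "summable f" using assms by (simp add: summable_cmult_iff)
  thus ?thesis by (simp add: suminf_mult)
qed simp

text \<open>The prefactor in r is moved inside the nested sums, where the summand becomes
  \<open>humbert_family\<close> by (2r)! = 4^r (1/2)_r r!. The nested sums are then identified from
  the inside outwards.\<close>

lemma humbert_Phi3_series:
  fixes z :: complex and y :: real
  assumes "y \<ge> 0"
  shows "(\<lambda>r. 1 / (of_nat (fact r) * pochhammer (1/2) r * pochhammer (1/2) (2 * r)) *
            Humbert_Phi3 (1/2) (1/2 + 2 * of_nat r) z (z * of_real y) * (z * of_real y / 2) ^ (2 * r))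
         sums infsum (humbert_family z y) UNIV"
proof -
  define c where "c r = 1 / (of_nat (fact r) * pochhammer (1/2) r * pochhammer (1/2) (2 * r)) * (z * of_real y / 2) ^ (2 * r)" for r
  define T where "T r m n = pochhammer (1/2) m / pochhammer (1/2 + 2 * of_nat r) (m + n) * z ^ m * (z * of_real y) ^ n
                 / (of_nat (fact m) * of_nat (fact n))" for r m n
  have phc: "pochhammer (1/2 :: complex) j = of_real (pochhammer (1/2) j)" for j
    using pochhammer_of_real[of "1/2" j, where 'a = complex] by simp
  have F: "c r * T r m n = humbert_family z y (r, m, n)" for r m n
  proof -
    have "pochhammer (1/2) (2 * r + (m + n)) = pochhammer (1/2 :: complex) (2 * r) * pochhammer (1/2 + 2 * of_nat r) (m + n)"
      using pochhammer_product'[of "1/2 :: complex" "2 * r" "m + n"] by simp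
    moreover have "fact (2 * r) = (4 ^ r * pochhammer (1/2) r * fact r :: complex)"
      using fact_double[of r, where ?'a = complex] by (simp add: power_mult)
    moreover have "(z * of_real y / 2) ^ (2 * r) = z ^ (2 * r) * of_real y ^ (2 * r) / 4 ^ r"
      by (simp add: power_divide power_mult_distrib power_mult)
    ultimately show ?thesis
      unfolding c_def T_def humbert_family_def prod.case
      by (simp add: power_add power_mult_distrib mult_ac flip: phc)
  qed
  note s = humbert_family_summable[OF assms, of z]
  note s1 = has_sum_imp_sums[OF has_sum_iterated(1)[OF s]] has_sum_iterated(2)[OF s]
  have s2: "(\<lambda>m. infsum (\<lambda>n. humbert_family z y (r, m, n)) UNIV) sums infsum (\<lambda>mn. humbert_family z y (r, mn)) UNIV"
    and s3: "(\<lambda>n. humbert_family z y (r, m, n)) summable_on UNIV" for r m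
    using has_sum_imp_sums[OF has_sum_iterated(1)[OF s1(2)[of r]]] has_sum_iterated(2)[OF s1(2)[of r]] by simp_all
  have s4: "(\<lambda>n. c r * T r m n) sums infsum (\<lambda>n. humbert_family z y (r, m, n)) UNIV" for r m
    unfolding F by (rule has_sum_imp_sums[OF has_sum_infsum[OF s3]])
  have s5: "c r * suminf (T r m) = infsum (\<lambda>n. humbert_family z y (r, m, n)) UNIV" for r m
    using suminf_cmult'[of "c r" "T r m"] s4[of r m] by (simp add: sums_iff)
  have "c r * (\<Sum>m. suminf (T r m)) = infsum (\<lambda>mn. humbert_family z y (r, mn)) UNIV" for r
    using suminf_cmult'[of "c r" "\<lambda>m. suminf (T r m)"] s2[of r] by (simp add: sums_iff s5)
  hence "(\<lambda>r. c r * (\<Sum>m. suminf (T r m))) sums infsum (humbert_family z y) UNIV"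
    using s1(1) by simp
  thus ?thesis
    unfolding c_def T_def Humbert_Phi3_def by (simp add: mult_ac)
qed

lemma humbert_weight_nonneg:
  assumes "y \<ge> 0"
  shows "humbert_weight k y \<ge> 0"
proof -
  have "pochhammer (1/2 :: real) m \<ge> 0" for m by (rule less_imp_le, rule pochhammer_pos) simp
  thus ?thesis using assms unfolding humbert_weight_def humbert_coeff_def
    by (intro sum_nonneg mult_nonneg_nonneg divide_nonneg_nonneg) auto
qed

lemma humbert_weight_bound:
  fixes A :: real
  assumes "A \<ge> 0"
  obtains C where "\<And>y. y \<ge> 0 \<Longrightarrow> \<exists>S. ((\<lambda>k. A ^ k * humbert_weight k y) has_sum S) UNIV \<and> S \<le> C * exp (y / 2)"
proof -
  obtain C where C: "\<And>y. y \<ge> 0 \<Longrightarrow> humbert_family A y summable_on UNIV"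
    "\<And>y. y \<ge> 0 \<Longrightarrow> infsum (humbert_family A y) UNIV \<le> C * exp (y / 2)"
    using humbert_family_bound[OF assms] by blast
  have "((\<lambda>k. A ^ k * humbert_weight k y) has_sum infsum (humbert_family A y) UNIV) UNIV" if y: "y \<ge> 0" for y
  proof -
    \<comment> \<open>The grouping by degree is available over the complex numbers; at a real point
      the complex family is the embedded real one, so the real statement can be read off.\<close>
    have "humbert_family (complex_of_real A) y = (\<lambda>x. of_real (humbert_family A y x))"
      by (auto simp: humbert_family_def)
    moreover have "((\<lambda>x. complex_of_real (humbert_family A y x)) has_sum of_real (infsum (humbert_family A y) UNIV)) UNIV"
      by (intro has_sum_of_real has_sum_infsum C y)
    ultimately have "infsum (humbert_family (complex_of_real A) y) UNIV = of_real (infsum (humbert_family A y) UNIV)"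
      by (simp add: infsumI)
    with humbert_family_by_degree[OF y, of "complex_of_real A"]
    have "((\<lambda>k. complex_of_real (A ^ k * humbert_weight k y)) has_sum of_real (infsum (humbert_family A y) UNIV)) UNIV"
      by simp
    thus ?thesis by (simp only: has_sum_of_real_iff)
  qed
  with that C(2) show ?thesis by blast
qed

text \<open>The exchange of the sums over n and k rests on absolute summability of \<open>P\<close>;
  its row norms are at most a constant times sigma_m1(n) exp (-y) exp (y/2).\<close>

lemma humbert_lambert_series:
  fixes a :: real and z :: complex
  assumes "a > 0"
  defines "y \<equiv> (\<lambda>n. 2 * real (Suc n) * a)"
  shows "summable (\<lambda>k. norm (z ^ k * of_real (humbert_lambert k a)))"
    and "(\<Sum>n. \<Sum>r. complex_of_real (sigma_m1 (Suc n) * exp (- 2 * real (Suc n) * a))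
          / (of_nat (fact r) * pochhammer (1/2) r * pochhammer (1/2) (2 * r))
          * Humbert_Phi3 (1/2) (1/2 + 2 * of_nat r) z (z * of_real (y n))
          * (z * of_real (y n) / 2) ^ (2 * r)) = (\<Sum>k. z ^ k * of_real (humbert_lambert k a))"
proof -
  define s where "s n = sigma_m1 (Suc n) * exp (- 2 * real (Suc n) * a)" for n
  define P where "P = (\<lambda>(n, k). complex_of_real (s n) * (z ^ k * of_real (humbert_weight k (y n))))"
  have y: "y n \<ge> 0" for n using assms by (simp add: y_def)
  have s_nonneg: "s n \<ge> 0" for n by (simp add: s_def sigma_m1_nonneg)
  obtain C where C: "\<And>y. y \<ge> 0 \<Longrightarrow> \<exists>S. ((\<lambda>k. norm z ^ k * humbert_weight k y) has_sum S) UNIV \<and> S \<le> C * exp (y / 2)"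
    using humbert_weight_bound[OF norm_ge_zero[of z]] by blast
  define S where "S n = (SOME S. ((\<lambda>k. norm z ^ k * humbert_weight k (y n)) has_sum S) UNIV \<and> S \<le> C * exp (y n / 2))" for n
  have S: "((\<lambda>k. norm z ^ k * humbert_weight k (y n)) has_sum S n) UNIV" "S n \<le> C * exp (y n / 2)" for n
    using someI_ex[OF C[OF y[of n]]] unfolding S_def by blast+
  have S_nonneg: "S n \<ge> 0" for n
    by (rule has_sum_nonneg[OF S(1)]) (use y humbert_weight_nonneg in auto)
  have nP: "((\<lambda>k. norm (P (n, k))) has_sum s n * S n) UNIV" for n
  proof -
    have "norm (P (n, k)) = s n * (norm z ^ k * humbert_weight k (y n))" for k
      using s_nonneg humbert_weight_nonneg[OF y] by (simp add: P_def norm_mult norm_power)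
    thus ?thesis using has_sum_cmult_right[OF S(1)] by simp
  qed
  \<comment> \<open>Half of the decay survives, so the majorant is the Lambert series at a /
    2.\<close>
  have "summable (\<lambda>n. C * (sigma_m1 (Suc n) * exp (- 2 * real (Suc n) * (a / 2))))"
    using lambert_moment_sums[of "a / 2" 0] assms by (intro summable_mult) (simp add: sums_iff)
  hence "summable (\<lambda>n. s n * S n)"
  proof (rule summable_comparison_test'[of _ 0])
    fix n :: nat
    have "norm (s n * S n) \<le> s n * (C * exp (y n / 2))"
      using s_nonneg S_nonneg S(2) by (simp add: mult_left_mono)
    also have "\<dots> = C * (sigma_m1 (Suc n) * (exp (- 2 * real (Suc n) * a) * exp (y n / 2)))"
      by (simp add: s_def)
    also have "exp (- 2 * real (Suc n) * a) * exp (y n / 2) = exp (- 2 * real (Suc n) * (a / 2))"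
    proof -
      have "- 2 * real (Suc n) * a + y n / 2 = - 2 * real (Suc n) * (a / 2)"
        by (simp add: y_def field_simps)
      thus ?thesis by (simp only: exp_add[symmetric])
    qed
    finally show "norm (s n * S n) \<le> C * (sigma_m1 (Suc n) * exp (- 2 * real (Suc n) * (a / 2)))" .
  qed
  hence "(\<lambda>n. s n * S n) summable_on UNIV"
    by (rule summable_nonneg_imp_summable_on) (use s_nonneg S_nonneg in auto)
  hence "(\<lambda>x. norm (P x)) summable_on (UNIV \<times> UNIV)"
    by (intro summable_on_SigmaI[OF nP]) auto
  hence sP: "P summable_on UNIV" by (simp add: abs_summable_summable)
  define Q where "Q = (\<lambda>(k, n). P (n, k))"
  have "(P has_sum infsum P UNIV) (UNIV \<times> UNIV)" using sP by simp
  hence Q: "(Q has_sum infsum P UNIV) UNIV"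
    by (subst (asm) has_sum_swap) (simp add: Q_def)
  hence sQ: "Q summable_on UNIV" and iQ: "infsum Q UNIV = infsum P UNIV"
    by (auto simp: summable_on_def infsumI)
  have inner: "infsum (\<lambda>n. Q (k, n)) UNIV = z ^ k * of_real (humbert_lambert k a)" for k
  proof -
    have "(\<lambda>n. \<Sum>N\<le>k. humbert_coeff k N * (sigma_m1 (Suc n) * (2 * real (Suc n) * a) ^ N * exp (- 2 * real (Suc n) * a)))
       sums humbert_lambert k a"
      unfolding humbert_lambert_def lambert_moment_def
      by (intro sums_sum sums_mult summable_sums sums_summable[OF lambert_moment_sums[OF assms(1)]])
    moreover have "(\<Sum>N\<le>k. humbert_coeff k N * (sigma_m1 (Suc n) * (2 * real (Suc n) * a) ^ N * exp (- 2 * real (Suc n) * a)))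
        = s n * humbert_weight k (y n)" for n
      by (simp add: s_def humbert_weight_def y_def sum_distrib_left mult_ac)
    ultimately have "(\<lambda>n. s n * humbert_weight k (y n)) sums humbert_lambert k a" by simp
    hence "(\<lambda>n. z ^ k * complex_of_real (s n * humbert_weight k (y n))) sums (z ^ k * of_real (humbert_lambert k a))"
      by (intro sums_mult sums_of_real)
    hence 1: "(\<lambda>n. Q (k, n)) sums (z ^ k * of_real (humbert_lambert k a))"
      by (simp add: Q_def P_def mult_ac)
    have "(\<lambda>n. Q (k, n)) sums infsum (\<lambda>n. Q (k, n)) UNIV"
      by (intro has_sum_imp_sums has_sum_infsum has_sum_iterated(2)[OF sQ])
    with 1 show ?thesis by (metis sums_unique2)
  qed
  have hs: "((\<lambda>k. z ^ k * of_real (humbert_lambert k a)) has_sum infsum P UNIV) UNIV"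
    using has_sum_iterated(1)[OF sQ] unfolding inner iQ .
  hence "(\<lambda>k. norm (z ^ k * of_real (humbert_lambert k a))) summable_on UNIV"
    by (metis summable_on_def summable_on_iff_abs_summable_on_complex)
  thus "summable (\<lambda>k. norm (z ^ k * of_real (humbert_lambert k a)))"
    by (rule summable_on_imp_summable)
  have "(\<Sum>r. complex_of_real (sigma_m1 (Suc n) * exp (- 2 * real (Suc n) * a))
          / (of_nat (fact r) * pochhammer (1/2) r * pochhammer (1/2) (2 * r))
          * Humbert_Phi3 (1/2) (1/2 + 2 * of_nat r) z (z * of_real (y n))
          * (z * of_real (y n) / 2) ^ (2 * r)) = infsum (\<lambda>k. P (n, k)) UNIV" (is "?L = _") for n
  proof -
    have "?L = of_real (s n) * infsum (humbert_family z (y n)) UNIV"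
      using sums_mult[OF humbert_Phi3_series[OF y[of n], of z], of "of_real (s n)"]
      by (simp add: sums_iff s_def mult_ac)
    also have "\<dots> = infsum (\<lambda>k. P (n, k)) UNIV"
      using has_sum_cmult_right[OF humbert_family_by_degree[OF y[of n], of z], of "of_real (s n)"]
      unfolding P_def prod.case by (rule infsumI[symmetric])
    finally show ?thesis .
  qed
  moreover have "(\<lambda>n. infsum (\<lambda>k. P (n, k)) UNIV) sums infsum P UNIV"
    by (rule has_sum_imp_sums[OF has_sum_iterated(1)[OF sP]])
  ultimately show "(\<Sum>n. \<Sum>r. complex_of_real (sigma_m1 (Suc n) * exp (- 2 * real (Suc n) * a))
          / (of_nat (fact r) * pochhammer (1/2) r * pochhammer (1/2) (2 * r))
          * Humbert_Phi3 (1/2) (1/2 + 2 * of_nat r) z (z * of_real (y n))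
          * (z * of_real (y n) / 2) ^ (2 * r)) = (\<Sum>k. z ^ k * of_real (humbert_lambert k a))"
    using has_sum_imp_sums[OF hs] by (simp add: sums_iff)
qed

section \<open>Closed forms of the coefficient series\<close>

lemma exp_times_power_series:
  fixes z :: complex and \<alpha> :: "nat \<Rightarrow> real"
  assumes "summable (\<lambda>k. norm (z ^ k * of_real (\<alpha> k)))"
  shows "(\<lambda>k. z ^ k * of_real (\<Sum>j\<le>k. (-1) ^ (k - j) / fact (k - j) * \<alpha> j)) sums
           (exp (- z) * (\<Sum>k. z ^ k * of_real (\<alpha> k)))"
proof -
  have e: "(\<lambda>i. (- z) ^ i / fact i) sums exp (- z)"
    using exp_converges[of "- z"] by (simp add: scaleR_conv_of_real field_simps)
  have "(\<lambda>i. norm (- z) ^ i / fact i) sums exp (norm (- z))"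
    using exp_converges[of "norm (- z)"] by (simp add: field_simps)
  hence "summable (\<lambda>i. norm ((- z) ^ i / fact i))"
    by (simp add: sums_iff norm_divide norm_power)
  from Cauchy_product_sums[OF assms this]
  have "(\<lambda>k. \<Sum>j\<le>k. z ^ j * of_real (\<alpha> j) * ((- z) ^ (k - j) / fact (k - j))) sums
      ((\<Sum>k. z ^ k * of_real (\<alpha> k)) * exp (- z))"
    using e by (simp add: sums_iff)
  moreover have "(\<Sum>j\<le>k. z ^ j * of_real (\<alpha> j) * ((- z) ^ (k - j) / fact (k - j))) =
       z ^ k * of_real (\<Sum>j\<le>k. (-1) ^ (k - j) / fact (k - j) * \<alpha> j)" for k
    unfolding of_real_sum sum_distrib_left
  proof (intro sum.cong refl)
    fix j assume "j \<in> {..k}"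
    hence "z ^ k = z ^ j * z ^ (k - j)" by (simp flip: power_add)
    thus "z ^ j * of_real (\<alpha> j) * ((- z) ^ (k - j) / fact (k - j)) =
        z ^ k * of_real ((-1) ^ (k - j) / fact (k - j) * \<alpha> j)"
      by (simp add: power_minus[of z])
  qed
  ultimately show ?thesis by (simp add: mult.commute)
qed

text \<open>The coefficients are p_k'(0). With k = m + 1, (1/2)_(m+1) = (3/2)_m / 2 and (2)_m =
  (m+1)! they become 2F2 coefficients; adding the values at z and -z keeps the even m, that is, the
  odd k.\<close>

lemma hyp2F2_odd_part_sums:
  "(\<lambda>k. z ^ k * of_real (if k = 0 then 0 else fact (k - 1) * (1 - (-1) ^ k) / (2 * pochhammer (1/2) k * fact k))) sums
     (z * (hyp2F2 1 1 (3/2) 2 z + hyp2F2 1 1 (3/2) 2 (- z)))"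
proof -
  define c where "c m = fact m / (pochhammer (3/2) m * fact (Suc m) :: real)" for m
  have ph: "pochhammer (3/2) m = complex_of_real (pochhammer (3/2) m)" for m
    using pochhammer_of_real[of "3/2" m, where 'a = complex] by simp
  have pos: "pochhammer (3/2 :: real) m > 0" for m by (rule pochhammer_pos) simp
  have "(\<lambda>m. of_real (c m) * z ^ m) sums hyp2F2 1 1 (3/2) 2 z" for z :: complex
  proof -
    have "pochhammer 2 m = (fact (Suc m) :: complex)" for m
      using pochhammer_rec[of "1 :: complex" m] by (simp add: pochhammer_fact)
    hence "pochhammer 1 m * pochhammer 1 m / (pochhammer (3/2) m * pochhammer 2 m) * z ^ m / of_nat (fact m) =
        of_real (c m) * z ^ m" for m
      by (simp add: c_def ph pochhammer_fact[symmetric] del: fact_Suc)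
    moreover have "summable (\<lambda>m. of_real (c m) * z ^ m)"
    proof (rule summable_comparison_test'[of _ 0])
      show "summable (\<lambda>m. norm (z ^ m / of_real (pochhammer (3/2) m)))"
        by (rule summable_power_over_pochhammer) simp
      fix m :: nat
      have "c m = 1 / (real (Suc m) * pochhammer (3/2) m)" by (simp add: c_def)
      also have "\<dots> \<le> 1 / (1 * pochhammer (3/2) m)"
        using pos[of m] by (intro divide_left_mono mult_right_mono mult_pos_pos) auto
      finally have "c m \<le> 1 / pochhammer (3/2) m" by simp
      moreover have "c m \<ge> 0" using pos[of m] by (simp add: c_def)
      ultimately show "norm (of_real (c m) * z ^ m) \<le> norm (z ^ m / of_real (pochhammer (3/2) m))"
        using pos[of m] mult_right_mono[of "c m" "1 / pochhammer (3/2) m" "norm z ^ m"]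
        by (simp add: norm_mult norm_divide norm_power)
    qed
    ultimately show ?thesis unfolding hyp2F2_def by (simp add: summable_sums)
  qed
  from sums_mult[OF sums_add[OF this this], of z z "- z"]
  have "(\<lambda>m. z * (of_real (c m) * z ^ m + of_real (c m) * (- z) ^ m)) sums
     (z * (hyp2F2 1 1 (3/2) 2 z + hyp2F2 1 1 (3/2) 2 (- z)))" .
  also have "(\<lambda>m. z * (of_real (c m) * z ^ m + of_real (c m) * (- z) ^ m)) =
    (\<lambda>m. z ^ Suc m * of_real (fact (Suc m - 1) * (1 - (-1) ^ Suc m) / (2 * pochhammer (1/2) (Suc m) * fact (Suc m))))"
  proof
    fix m
    have "pochhammer (1/2 :: real) (Suc m) = 1 / 2 * pochhammer (3/2) m"
      by (simp add: pochhammer_rec)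
    hence "fact (Suc m - 1) * (1 - (-1) ^ Suc m) / (2 * pochhammer (1/2) (Suc m) * fact (Suc m)) = c m * (1 + (-1) ^ m)"
      by (simp add: c_def)
    thus "z * (of_real (c m) * z ^ m + of_real (c m) * (- z) ^ m) =
      z ^ Suc m * of_real (fact (Suc m - 1) * (1 - (-1) ^ Suc m) / (2 * pochhammer (1/2) (Suc m) * fact (Suc m)))"
      by (simp only:) (simp add: power_minus[of z] algebra_simps)
  qed
  finally show ?thesis
    using sums_Suc_iff[of "\<lambda>k. z ^ k * of_real (if k = 0 then 0 else fact (k - 1) * (1 - (-1) ^ k) / (2 * pochhammer (1/2) k * fact k))"]
    by simp
qed

text \<open>The series is 1F1(1; 1/2; x) = 1 + 2 x 1F1(1; 3/2; x) at x = c v^2, and the latter is a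
  Gaussian integral in disguise. The parameter c treats erf (c = 1) and erfi (c = -1)
  together.\<close>

lemma kummer_1_half_sums_gaussian:
  fixes c v :: complex
  shows "(\<lambda>k. (c * v\<^sup>2) ^ k / of_real (pochhammer (1/2) k)) sums
     (1 + 2 * c * v * exp (c * v\<^sup>2) * contour_integral (linepath 0 v) (\<lambda>t. exp (- (c * t\<^sup>2))))"
proof -
  define m where "m k = complex_of_real (1 / pochhammer (3/2) k)" for k
  define M where "M x = (\<Sum>k. m k * x ^ k)" for x
  define M' where "M' x = (\<Sum>k. diffs m k * x ^ k)" for x
  have pos: "pochhammer (3/2 :: real) k > 0" for k by (rule pochhammer_pos) simp
  have sm: "summable (\<lambda>k. m k * x ^ k)" for x
    using summable_norm_cancel[OF summable_power_over_pochhammer[of "3/2" x]] by (simp add: m_def)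
  have dM: "(M has_field_derivative M' x) (at x)" for x
    unfolding M_def M'_def by (rule termdiffs_strong_converges_everywhere) (rule sm)
  \<comment> \<open>Coefficientwise this is (2 k + 3) m_(k+1) = 2 m_k, which is the recurrence of
    (3/2)_k; the constant 1 is m_0.\<close>
  have ode: "M x + 2 * x * M' x = 1 + 2 * x * M x" for x
  proof -
    have "summable (\<lambda>k. diffs m k * x ^ k)"
      by (rule termdiff_converges_all) (rule sm)
    hence "(\<lambda>k. x * (diffs m k * x ^ k)) sums (x * M' x)"
      unfolding M'_def by (intro sums_mult summable_sums)
    also have "(\<lambda>k. x * (diffs m k * x ^ k)) = (\<lambda>k. of_nat (Suc k) * m (Suc k) * x ^ Suc k)"
      by (simp add: diffs_def mult_ac)
    finally have "(\<lambda>k. of_nat k * m k * x ^ k) sums (x * M' x)"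
      by (subst (asm) sums_Suc_iff) simp
    from sums_add[OF summable_sums[OF sm[of x]] sums_mult[OF this, of 2]]
    have A: "(\<lambda>k. m k * x ^ k + 2 * (of_nat k * m k * x ^ k)) sums (M x + 2 * x * M' x)"
      by (simp add: M_def mult_ac)
    have "(\<lambda>k. 2 * x * (m k * x ^ k)) sums (2 * x * M x)"
      unfolding M_def by (intro sums_mult summable_sums sm)
    also have "(\<lambda>k. 2 * x * (m k * x ^ k)) = (\<lambda>k. m (Suc k) * x ^ Suc k + 2 * (of_nat (Suc k) * m (Suc k) * x ^ Suc k))"
    proof
      fix k
      have "1 / pochhammer (3/2) k = 1 / pochhammer (3/2) (Suc k) * (3 / 2 + real k)"
        using pos[of k] by (simp add: pochhammer_Suc)
      hence "m k = m (Suc k) * of_real (3 / 2 + real k)"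
        unfolding m_def by (simp only: of_real_mult)
      thus "2 * x * (m k * x ^ k) = m (Suc k) * x ^ Suc k + 2 * (of_nat (Suc k) * m (Suc k) * x ^ Suc k)"
        by (simp add: algebra_simps)
    qed
    finally have "(\<lambda>k. m k * x ^ k + 2 * (of_nat k * m k * x ^ k)) sums (2 * x * M x + 1)"
      by (subst (asm) sums_Suc_iff) (simp add: m_def)
    from sums_unique2[OF A this] show ?thesis by (simp only: add.commute)
  qed
  \<comment> \<open>The differential equation for M says exactly that this is an antiderivative of
    exp (-c v^2), vanishing at 0.\<close>
  define F where "F v = exp (- (c * v\<^sup>2)) * (v * M (c * v\<^sup>2))" for v
  have dF: "(F has_field_derivative exp (- (c * v\<^sup>2))) (at v)" for v
  proof -
    have "((\<lambda>v. M (c * v\<^sup>2)) has_field_derivative M' (c * v\<^sup>2) * (2 * c * v)) (at v)"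
    proof -
      have "((\<lambda>v. c * v\<^sup>2) has_field_derivative 2 * c * v) (at v)"
        by (auto intro!: derivative_eq_intros)
      from DERIV_chain'[OF this dM] show ?thesis by (simp add: mult_ac)
    qed
    hence "(F has_field_derivative
        exp (- (c * v\<^sup>2)) * (- (2 * c * v)) * (v * M (c * v\<^sup>2)) +
        (1 * M (c * v\<^sup>2) + M' (c * v\<^sup>2) * (2 * c * v) * v) * exp (- (c * v\<^sup>2))) (at v)"
      unfolding F_def by (intro DERIV_mult DERIV_ident) (auto intro!: derivative_eq_intros)
    also have "exp (- (c * v\<^sup>2)) * (- (2 * c * v)) * (v * M (c * v\<^sup>2)) +
        (1 * M (c * v\<^sup>2) + M' (c * v\<^sup>2) * (2 * c * v) * v) * exp (- (c * v\<^sup>2)) =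
       exp (- (c * v\<^sup>2)) * ((M (c * v\<^sup>2) + 2 * (c * v\<^sup>2) * M' (c * v\<^sup>2)) - 2 * (c * v\<^sup>2) * M (c * v\<^sup>2))"
      by (simp add: algebra_simps power2_eq_square)
    finally show ?thesis unfolding ode by simp
  qed
  have "((\<lambda>t. exp (- (c * t\<^sup>2))) has_contour_integral (F (pathfinish (linepath 0 v)) - F (pathstart (linepath 0 v)))) (linepath 0 v)"
    by (rule contour_integral_primitive[of UNIV, OF _ valid_path_linepath]) (use dF in auto)
  hence I: "contour_integral (linepath 0 v) (\<lambda>t. exp (- (c * t\<^sup>2))) = F v"
    by (simp add: contour_integral_unique F_def)
  have "(\<lambda>k. 2 * (c * v\<^sup>2) * (m k * (c * v\<^sup>2) ^ k)) sums (2 * (c * v\<^sup>2) * M (c * v\<^sup>2))"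
    unfolding M_def by (intro sums_mult summable_sums sm)
  also have "(\<lambda>k. 2 * (c * v\<^sup>2) * (m k * (c * v\<^sup>2) ^ k)) = (\<lambda>k. (c * v\<^sup>2) ^ Suc k / of_real (pochhammer (1/2) (Suc k)))"
    by (auto simp: m_def pochhammer_rec)
  finally have "(\<lambda>k. (c * v\<^sup>2) ^ k / of_real (pochhammer (1/2) k)) sums (2 * (c * v\<^sup>2) * M (c * v\<^sup>2) + 1)"
    by (subst (asm) sums_Suc_iff) simp
  also have "2 * (c * v\<^sup>2) * M (c * v\<^sup>2) + 1 = 1 + 2 * c * v * exp (c * v\<^sup>2) * F v"
    by (simp add: F_def power2_eq_square mult_ac exp_minus)
  finally show ?thesis unfolding I .
qed

theorem theorem1p4:
  fixes w :: complex and a b :: real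
  assumes "a > 0" and "b > 0" and "a * b = pi ^ 2"
  shows "exp (- (w ^ 2) / 4) *
      (\<Sum>n. \<Sum>r. complex_of_real (sigma_m1 (Suc n) * exp (- 2 * real (Suc n) * a))
          / (of_nat (fact r) * pochhammer (1/2) r * pochhammer (1/2) (2 * r))
          * Humbert_Phi3 (1/2) (1/2 + 2 * of_nat r) (w ^ 2 / 4) (w ^ 2 * of_nat (Suc n) * of_real a / 2)
          * (w ^ 2 * of_nat (Suc n) * of_real a / 4) ^ (2 * r))
    - exp (w ^ 2 / 4) *
      (\<Sum>n. \<Sum>r. complex_of_real (sigma_m1 (Suc n) * exp (- 2 * real (Suc n) * b))
          / (of_nat (fact r) * pochhammer (1/2) r * pochhammer (1/2) (2 * r))
          * Humbert_Phi3 (1/2) (1/2 + 2 * of_nat r) (- (w ^ 2) / 4) (- (w ^ 2 * of_nat (Suc n) * of_real b / 2))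
          * (w ^ 2 * of_nat (Suc n) * of_real b / 4) ^ (2 * r))
    = 1/4 * (complex_of_real (ln (a / b))
          - w ^ 2 / 2 * (hyp2F2 1 1 (3/2) 2 (w ^ 2 / 4) + hyp2F2 1 1 (3/2) 2 (- (w ^ 2) / 4)))
      + 1/12 * (of_real b * (1 + w * of_real (sqrt pi) / 2 * exp (w ^ 2 / 4) * cerf (w / 2))
              - of_real a * (1 - w * of_real (sqrt pi) / 2 * exp (- (w ^ 2) / 4) * cerfi (w / 2)))"
proof -
  define z where "z = w ^ 2 / 4"
  define \<alpha> where "\<alpha> x k = (\<Sum>j\<le>k. (-1) ^ (k - j) / fact (k - j) * humbert_lambert j x)" for x k
  define SA where "SA = (\<Sum>n. \<Sum>r. complex_of_real (sigma_m1 (Suc n) * exp (- 2 * real (Suc n) * a))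
          / (of_nat (fact r) * pochhammer (1/2) r * pochhammer (1/2) (2 * r))
          * Humbert_Phi3 (1/2) (1/2 + 2 * of_nat r) (w ^ 2 / 4) (w ^ 2 * of_nat (Suc n) * of_real a / 2)
          * (w ^ 2 * of_nat (Suc n) * of_real a / 4) ^ (2 * r))"
  define SB where "SB = (\<Sum>n. \<Sum>r. complex_of_real (sigma_m1 (Suc n) * exp (- 2 * real (Suc n) * b))
          / (of_nat (fact r) * pochhammer (1/2) r * pochhammer (1/2) (2 * r))
          * Humbert_Phi3 (1/2) (1/2 + 2 * of_nat r) (- (w ^ 2) / 4) (- (w ^ 2 * of_nat (Suc n) * of_real b / 2))
          * (w ^ 2 * of_nat (Suc n) * of_real b / 4) ^ (2 * r))"
  \<comment> \<open>Since w^2 = 4 z, all arguments are expressed by z and y = 2 n x.\<close>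
  have arg: "w ^ 2 * of_nat (Suc n) * of_real x / 2 = z * of_real (2 * real (Suc n) * x)"
     "w ^ 2 * of_nat (Suc n) * of_real x / 4 = z * of_real (2 * real (Suc n) * x) / 2" for n x
    by (simp_all add: z_def field_simps)
  have A: "(\<lambda>k. z ^ k * of_real (\<alpha> a k)) sums (exp (- z) * SA)"
    using exp_times_power_series[OF humbert_lambert_series(1)[OF assms(1), of z]]
    unfolding \<alpha>_def SA_def arg z_def[symmetric] humbert_lambert_series(2)[OF assms(1)] .
  \<comment> \<open>The b side is the same series at -z: the base of the power 2 r carries no sign
    in the statement, but the exponent is even.\<close>
  have neg: "- (z * t) = (- z) * t" "(z * t / 2) ^ (2 * r) = ((- z) * t / 2) ^ (2 * r)" for t r
    by (simp_all add: power_mult)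
  have "(\<lambda>k. (- z) ^ k * of_real (\<alpha> b k)) sums (exp (- (- z)) * SB)"
    using exp_times_power_series[OF humbert_lambert_series(1)[OF assms(2), of "- z"]]
    unfolding \<alpha>_def SB_def arg minus_divide_left[symmetric] z_def[symmetric] neg humbert_lambert_series(2)[OF assms(2)] .
  hence B: "(\<lambda>k. z ^ k * of_real ((-1) ^ k * \<alpha> b k)) sums (exp z * SB)"
    by (simp add: power_minus[of z] mult_ac)
  have L: "(\<lambda>k. z ^ k * of_real (\<alpha> a k - (-1) ^ k * \<alpha> b k)) sums (exp (- z) * SA - exp z * SB)"
    using sums_diff[OF A B] by (simp add: algebra_simps)
  \<comment> \<open>K(z) and K(-z) are the generating functions of p_k(1) and p_k(-1).\<close>
  define K where "K x = (\<Sum>k. x ^ k / of_real (pochhammer (1/2) k))" for x :: complex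
  have K: "(\<lambda>k. x ^ k / of_real (pochhammer (1/2) k)) sums K x" for x :: complex
    unfolding K_def by (rule summable_sums[OF summable_norm_cancel[OF summable_power_over_pochhammer]]) simp
  have "(\<lambda>k. (if k = 0 then of_real (ln (a / b) / 4) else 0)
      - 1 / 2 * (z ^ k * of_real (if k = 0 then 0 else fact (k - 1) * (1 - (-1) ^ k) / (2 * pochhammer (1/2) k * fact k)))
      + (of_real b / 12 * (z ^ k / of_real (pochhammer (1/2) k)) - of_real a / 12 * ((- z) ^ k / of_real (pochhammer (1/2) k))))
    sums (of_real (ln (a / b) / 4) - 1 / 2 * (z * (hyp2F2 1 1 (3/2) 2 z + hyp2F2 1 1 (3/2) 2 (- z)))
      + (of_real b / 12 * K z - of_real a / 12 * K (- z)))"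
    by (intro sums_add sums_diff sums_mult K hyp2F2_odd_part_sums sums_single)
  moreover have "(if k = 0 then of_real (ln (a / b) / 4) else 0)
      - 1 / 2 * (z ^ k * of_real (if k = 0 then 0 else fact (k - 1) * (1 - (-1) ^ k) / (2 * pochhammer (1/2) k * fact k)))
      + (of_real b / 12 * (z ^ k / of_real (pochhammer (1/2) k)) - of_real a / 12 * ((- z) ^ k / of_real (pochhammer (1/2) k)))
     = z ^ k * of_real (\<alpha> a k - (-1) ^ k * \<alpha> b k)" for k
    unfolding \<alpha>_def humbert_lambert_transformation[OF assms]
    by (cases "k = 0") (simp_all add: power_minus[of z] algebra_simps diff_divide_distrib add_divide_distrib)
  ultimately have R: "exp (- z) * SA - exp z * SB =
     of_real (ln (a / b) / 4) - 1 / 2 * (z * (hyp2F2 1 1 (3/2) 2 z + hyp2F2 1 1 (3/2) 2 (- z)))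
      + (of_real b / 12 * K z - of_real a / 12 * K (- z))"
    using L by (simp add: sums_iff)
  \<comment> \<open>For v = w / 2 one has v^2 = z and 2 v = w.\<close>
  have "K z = 1 + w * exp z * contour_integral (linepath 0 (w / 2)) (\<lambda>t. exp (- (t\<^sup>2)))"
    using kummer_1_half_sums_gaussian[of 1 "w / 2"] K[of z]
    by (simp add: sums_iff z_def power_divide)
  hence K1: "K z = 1 + w * of_real (sqrt pi) / 2 * exp z * cerf (w / 2)"
    by (simp add: cerf_def)
  have "K (- z) = 1 - w * exp (- z) * contour_integral (linepath 0 (w / 2)) (\<lambda>t. exp (t\<^sup>2))"
    using kummer_1_half_sums_gaussian[of "-1" "w / 2"] K[of "- z"]
    by (simp add: sums_iff z_def power_divide)
  hence K2: "K (- z) = 1 - w * of_real (sqrt pi) / 2 * exp (- z) * cerfi (w / 2)"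
    by (simp add: cerfi_def)
  have w: "w ^ 2 / 4 = z" "- (w ^ 2) / 4 = - z" "w ^ 2 / 2 = 2 * z" by (simp_all add: z_def)
  show ?thesis
    unfolding SA_def[symmetric] SB_def[symmetric]
    unfolding w R K1 K2 by (simp add: algebra_simps add_divide_distrib diff_divide_distrib)
qed

end
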